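(* Consider Continuum Glauber dynamics for the hard sphere model with activity $\lambda$ on a bounded measurable region $\Lambda\subseteq\mathbb{R}^d$, started from the empty configuration, and let $\gamma>0$ be such that $\mathcal E(f,f)\ge\gamma\operatorname{Var}_\mu(f)$ for all bounded measurable $f$ (the Poincaré constant). Then its mixing time is $O\big(\frac1\gamma\lambda|\Lambda|+(1+\frac1\gamma)\log(1/\epsilon)\big)$: there is an absolute constant $C$ such that for every $\epsilon\in(0,1)$ and every $t\ge C\big(\frac1\gamma\lambda|\Lambda|+(1+\frac1\gamma)\log(1/\epsilon)\big)$, the law $\mu_t$ of the dynamics at time $t$ satisfies $d_{TV}(\mu_t,\mu)\le\epsilon$.
   Context: $\mu$ is the hard sphere distribution: the Poisson point process of intensity $\lambda$ on $\Lambda$ conditioned on all pairwise distances being at least $2r$. Continuum Glauber dynamics: each point is removed at rate $1$; new points are added at rate $\lambda$ per unit volume at locations at distance at least $2r$ from all current points. $\mathcal E(f,f)=\int\sum_{x\in\eta}(f(\eta\setminus\{x\})-f(\eta))^2d\mu(\eta)$. *)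

theory Defs
  imports "HOL-Probability.Probability"
begin

text \<open>
  The dimension is a natural number and not a type, so that a constant can be chosen uniformly
  in it. A point of \<open>\<real>\<^sup>d\<close> is a function on \<open>nat\<close> that is extensional on \<open>{..<d}\<close>.
\<close>

type_synonym point = "nat \<Rightarrow> real"

definition euclid :: "nat \<Rightarrow> point measure" where
  "euclid d = (\<Pi>\<^sub>M i\<in>{..<d}. (lborel :: real measure))"

definition edist :: "nat \<Rightarrow> point \<Rightarrow> point \<Rightarrow> real" where
  "edist d x y = L2_set (\<lambda>i. x i - y i) {..<d}"

definition bounded_region :: "nat \<Rightarrow> point set \<Rightarrow> bool" where
  "bounded_region d \<Lambda> \<longleftrightarrow> (\<exists>R. \<forall>x\<in>\<Lambda>. L2_set x {..<d} \<le> R)"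

definition vol :: "nat \<Rightarrow> point set \<Rightarrow> real" where
  "vol d \<Lambda> = measure (euclid d) \<Lambda>"

text \<open>
  Configurations are finite sets of points, with the sigma-algebra generated by the counts
  \<open>\<eta> \<mapsto> card (\<eta> \<inter> B)\<close> for Borel sets \<open>B\<close>.
\<close>

definition configs :: "nat \<Rightarrow> point set set" where
  "configs d = {\<eta>. finite \<eta> \<and> \<eta> \<subseteq> space (euclid d)}"

definition config_space :: "nat \<Rightarrow> point set measure" where
  "config_space d =
     sigma (configs d) {{\<eta> \<in> configs d. card (\<eta> \<inter> B) = k} | B k. B \<in> sets (euclid d)}"

text \<open>
  The Poisson point process on a region of finite volume: a Poisson number of independent uniform
  points. The case distinction is needed because \<^const>\<open>poisson_pmf\<close> is only specified for a
  positive rate. For \<open>d \<ge> 1\<close> the \<open>n\<close> points are almost surely distinct, so that nothing is lost by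
  passing to the set of points.
\<close>

definition poisson_process :: "nat \<Rightarrow> real \<Rightarrow> point set \<Rightarrow> point set measure" where
  "poisson_process d lam \<Lambda> =
     (let m = lam * vol d \<Lambda> in
      bind (measure_pmf (if m = 0 then return_pmf 0 else poisson_pmf m))
        (\<lambda>n. distr (\<Pi>\<^sub>M i\<in>{..<n}. uniform_measure (euclid d) \<Lambda>) (config_space d)
               (\<lambda>x. x ` {..<n})))"

definition hard_core :: "nat \<Rightarrow> real \<Rightarrow> point set \<Rightarrow> bool" where
  "hard_core d r \<eta> \<longleftrightarrow> (\<forall>x\<in>\<eta>. \<forall>y\<in>\<eta>. x \<noteq> y \<longrightarrow> 2 * r \<le> edist d x y)"

definition hard_sphere :: "nat \<Rightarrow> real \<Rightarrow> real \<Rightarrow> point set \<Rightarrow> point set measure" where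
  "hard_sphere d r lam \<Lambda> =
     uniform_measure (poisson_process d lam \<Lambda>) {\<eta> \<in> configs d. hard_core d r \<eta>}"

text \<open>
  A jump process is specified by its rates: \<open>Q \<eta> h\<close> is the integral of \<open>h\<close> against the measure of
  jump rates out of the state \<open>\<eta>\<close>, so that \<open>Q \<eta> (\<lambda>_. 1)\<close> is the total rate of leaving \<open>\<eta>\<close>.
  \<open>jump_prob Q n t \<eta> A\<close> is the probability that the process started from \<open>\<eta>\<close> makes at most \<open>n\<close>
  jumps up to time \<open>t\<close> and is in \<open>A\<close> at time \<open>t\<close>. The recursion conditions on the first jump: it
  happens after an exponential time \<open>s\<close> whose rate is the exit rate of \<open>\<eta>\<close>, and its target is
  distributed proportionally to the jump rates. Letting \<open>n\<close> tend to infinity gives Feller's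
  transition function, that is, the law of the jump process at time \<open>t\<close>.
\<close>

definition exit_rate :: "('s \<Rightarrow> ('s \<Rightarrow> ennreal) \<Rightarrow> ennreal) \<Rightarrow> 's \<Rightarrow> real" where
  "exit_rate Q \<eta> = enn2real (Q \<eta> (\<lambda>_. 1))"

primrec jump_prob ::
  "('s \<Rightarrow> ('s \<Rightarrow> ennreal) \<Rightarrow> ennreal) \<Rightarrow> nat \<Rightarrow> real \<Rightarrow> 's \<Rightarrow> 's set \<Rightarrow> ennreal" where
  "jump_prob Q 0 t \<eta> A = ennreal (exp (- exit_rate Q \<eta> * t)) * indicator A \<eta>"
| "jump_prob Q (Suc n) t \<eta> A =
     ennreal (exp (- exit_rate Q \<eta> * t)) * indicator A \<eta> +
     (\<integral>\<^sup>+ s\<in>{0..t}. ennreal (exp (- exit_rate Q \<eta> * s)) *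
        Q \<eta> (\<lambda>\<eta>'. jump_prob Q n (t - s) \<eta>' A) \<partial>lborel)"

definition jump_law ::
  "'s measure \<Rightarrow> ('s \<Rightarrow> ('s \<Rightarrow> ennreal) \<Rightarrow> ennreal) \<Rightarrow> 's \<Rightarrow> real \<Rightarrow> 's measure" where
  "jump_law S Q \<eta>0 t = measure_of (space S) (sets S) (\<lambda>A. SUP n. jump_prob Q n t \<eta>0 A)"

definition glauber_rates ::
  "nat \<Rightarrow> real \<Rightarrow> real \<Rightarrow> point set \<Rightarrow> point set \<Rightarrow> (point set \<Rightarrow> ennreal) \<Rightarrow> ennreal" where
  "glauber_rates d r lam \<Lambda> \<eta> h =
     (\<Sum>x\<in>\<eta>. h (\<eta> - {x})) +
     ennreal lam *
       (\<integral>\<^sup>+ x\<in>{x \<in> \<Lambda>. \<forall>y\<in>\<eta>. 2 * r \<le> edist d x y}. h (insert x \<eta>) \<partial>euclid d)"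

definition glauber_law :: "nat \<Rightarrow> real \<Rightarrow> real \<Rightarrow> point set \<Rightarrow> real \<Rightarrow> point set measure" where
  "glauber_law d r lam \<Lambda> t = jump_law (config_space d) (glauber_rates d r lam \<Lambda>) {} t"

definition dirichlet_form :: "point set measure \<Rightarrow> (point set \<Rightarrow> real) \<Rightarrow> real" where
  "dirichlet_form \<mu> f = (LINT \<eta>|\<mu>. (\<Sum>x\<in>\<eta>. (f (\<eta> - {x}) - f \<eta>)\<^sup>2))"

definition Var :: "'s measure \<Rightarrow> ('s \<Rightarrow> real) \<Rightarrow> real" where
  "Var \<mu> f = (LINT \<eta>|\<mu>. (f \<eta> - (LINT \<xi>|\<mu>. f \<xi>))\<^sup>2)"

definition poincare :: "nat \<Rightarrow> real \<Rightarrow> point set measure \<Rightarrow> bool" where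
  "poincare d \<gamma> \<mu> \<longleftrightarrow>
     (\<forall>f. f \<in> borel_measurable (config_space d) \<longrightarrow>
          (\<exists>b. \<forall>\<eta>\<in>configs d. \<bar>f \<eta>\<bar> \<le> b) \<longrightarrow>
          dirichlet_form \<mu> f \<ge> \<gamma> * Var \<mu> f)"

definition tv_dist :: "'s measure \<Rightarrow> 's measure \<Rightarrow> real" where
  "tv_dist M N = (SUP A\<in>sets M. \<bar>measure M A - measure N A\<bar>)"

end

theory Submission
  imports Defs
begin

text \<open>
  The empty configuration is an atom of the hard sphere measure \<open>\<mu>\<close>, of mass at least
  \<open>exp (- \<lambda>|\<Lambda>|)\<close>. Hence for every event \<open>A\<close> the transition probability \<open>P\<^sub>t 1\<^sub>A\<close> at the empty
  configuration differs from \<open>\<mu> A\<close> by at most \<open>exp (\<lambda>|\<Lambda>| / 2)\<close> times its standard deviation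
  under \<open>\<mu>\<close>. By the Mecke formula for the Poisson process the insertion and removal parts of the
  generator are adjoint, so the mean of \<open>P\<^sub>t 1\<^sub>A\<close> is constant in \<open>t\<close> and the Poincare inequality
  makes its variance decay like \<open>exp (- 2\<gamma>t)\<close>. Since hard core configurations in a bounded region have
  bounded cardinality, the rates are bounded along the dynamics; the backward equation then
  gives a second order expansion of \<open>P\<^sub>t 1\<^sub>A\<close> in \<open>t\<close>, uniformly in the configuration, from which the
  decay follows by iterating over small time steps.
\<close>

subsection \<open>Jump processes with bounded rates\<close>

text \<open>\<open>jump_law\<close> is given only as a limit of first-jump recursions, so neither
  differentiability in time nor the semigroup law is at hand. Comparing the backward equation at the
  times t and t + h replaces both: a local error of order h^2, summed over T/h steps, tends to 0
  with h. An obstacle is that the rates are unbounded on the space of all configurations, where the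
  number of points is arbitrary. The analysis is therefore confined to a set \<open>X\<close> that
  the dynamics cannot leave and that carries all of \<mu>. The Dirichlet form counts removals only
  and has no factor 1/2. By reversibility it still equals the full quadratic form -\<integral> f L f
  d\<mu> of the generator L, since insertions contribute as much as removals; hence the rate
  2\<gamma> for the variance. Passing to the square root gives exp (- \<gamma> t) against the factor
  exp (\<lambda>|\<Lambda>| / 2) from the atom, which is why the constant C = 1 is enough.\<close>

lemma exp_minus_le_quadratic:
  fixes x :: real
  assumes "0 \<le> x"
  shows "exp (- x) \<le> 1 - x + x\<^sup>2"
proof -
  have "exp (- x) \<le> 1 / (1 + x)"
    using assms exp_ge_add_one_self[of x] by (simp add: exp_minus field_simps)
  also have "\<dots> \<le> 1 - x + x\<^sup>2"
  proof -
    have "(1 - x + x\<^sup>2) * (1 + x) = 1 + x ^ 3"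
      by (simp add: algebra_simps power2_eq_square power3_eq_cube)
    then have "1 \<le> (1 - x + x\<^sup>2) * (1 + x)"
      using assms by simp
    then show ?thesis
      using assms by (simp add: divide_le_eq)
  qed
  finally show ?thesis .
qed

text \<open>\<open>n\<close> steps of length \<open>T / n\<close> turn the factor into
  \<open>(1 - a * T / n) ^ n\<close>, at most \<open>exp (- a * T)\<close>, while the accumulated
  error is at most \<open>n * c * (T / n)\<^sup>2 = c * T\<^sup>2 / n\<close>, which vanishes as
  \<open>n\<close> grows. This stands in for the differential inequality \<phi>' \<le> - a \<phi>
  without any derivative of \<phi>; it serves the mean with \<open>a = 0\<close> and the variance
  with \<open>a = 2 * \<gamma>\<close>.\<close>

lemma discrete_gronwall:
  fixes \<phi> :: "real \<Rightarrow> real"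
  assumes step: "\<And>t h. 0 \<le> t \<Longrightarrow> 0 \<le> h \<Longrightarrow> \<phi> (t + h) \<le> (1 - a * h) * \<phi> t + c * h\<^sup>2"
    and "0 \<le> a" "0 \<le> c" "0 \<le> \<phi> 0" "0 \<le> T"
  shows "\<phi> T \<le> exp (- a * T) * \<phi> 0"
proof -
  \<comment> \<open>The condition \<open>a * T \<le> real n\<close> keeps \<open>1 - a * h\<close>
    nonnegative, so that the induction hypothesis can be multiplied by it.\<close>
  have bound: "\<phi> T \<le> exp (- a * T) * \<phi> 0 + c * T\<^sup>2 / n" if n: "0 < n" "a * T \<le> real n" for n :: nat
  proof -
    define h where "h = T / n"
    have h: "0 \<le> h" "a * h \<le> 1" "0 \<le> a * h"
      using n assms by (auto simp: h_def field_simps)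
    have "\<phi> (k * h) \<le> (1 - a * h) ^ k * \<phi> 0 + k * (c * h\<^sup>2)" for k :: nat
    proof (induction k)
      case (Suc k)
      have "\<phi> (Suc k * h) = \<phi> (k * h + h)"
        by (simp add: algebra_simps)
      also have "\<dots> \<le> (1 - a * h) * \<phi> (k * h) + c * h\<^sup>2"
        using h by (intro step) auto
      also have "\<dots> \<le> (1 - a * h) * ((1 - a * h) ^ k * \<phi> 0 + k * (c * h\<^sup>2)) + c * h\<^sup>2"
        using Suc h by (intro add_mono mult_left_mono order_refl) auto
      also have "\<dots> \<le> (1 - a * h) ^ Suc k * \<phi> 0 + 1 * (k * (c * h\<^sup>2)) + c * h\<^sup>2"
        unfolding distrib_left power_Suc mult.assoc
        using h assms by (intro add_mono order_refl mult_right_mono mult_nonneg_nonneg) auto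
      finally show ?case
        by (simp add: algebra_simps)
    qed simp
    from this[of n] have "\<phi> T \<le> (1 - a * h) ^ n * \<phi> 0 + n * (c * h\<^sup>2)"
      using n by (simp add: h_def)
    also have "(1 - a * h) ^ n \<le> exp (- (a * h)) ^ n"
      using h exp_ge_add_one_self[of "- (a * h)"] by (intro power_mono) auto
    also have "exp (- (a * h)) ^ n = exp (- a * T)"
      using n by (simp add: exp_of_nat_mult[symmetric] h_def)
    also have "n * (c * h\<^sup>2) = c * T\<^sup>2 / n"
      using n by (simp add: h_def power2_eq_square)
    finally show ?thesis
      using assms by (simp add: mult_right_mono)
  qed
  have "(\<lambda>n. exp (- a * T) * \<phi> 0 + c * T\<^sup>2 / real n) \<longlonglongrightarrow> exp (- a * T) * \<phi> 0 + 0"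
    by (intro tendsto_add tendsto_const tendsto_divide_0[OF tendsto_const]
        filterlim_at_top_imp_at_infinity filterlim_real_sequentially)
  moreover have "\<forall>\<^sub>F n in sequentially. \<phi> T \<le> exp (- a * T) * \<phi> 0 + c * T\<^sup>2 / real n"
    using eventually_gt_at_top[of 0] eventually_ge_at_top[of "nat \<lceil>a * T\<rceil>"]
  proof eventually_elim
    case (elim n)
    then show ?case
      by (intro bound) linarith+
  qed
  ultimately show ?thesis
    by (metis add.right_neutral tendsto_lowerbound trivial_limit_sequentially)
qed

text \<open>\<open>Q \<eta>\<close> plays the role of integration against a kernel of jump rates.
  \<open>Q_cong\<close> encodes that from \<open>X\<close> the process jumps only into
  \<open>X\<close>, so that the bound on the rates is asked for there alone. \<open>Q_mono\<close>
  is demanded at every state because the monotonicity of \<open>jump_prob\<close> in the number of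
  jumps is proved at every state. In \<open>Q_measurable\<close> the integrand carries a time
  parameter, since the recursion for \<open>jump_prob\<close> evaluates it at
  \<open>t - s\<close>.\<close>

locale jump_rates =
  fixes S :: "'s measure" and Q :: "'s \<Rightarrow> ('s \<Rightarrow> ennreal) \<Rightarrow> ennreal"
    and X :: "'s set" and b :: real
  assumes X_space: "X \<subseteq> space S"
    and b_nonneg: "0 \<le> b"
    and Q_mono: "\<And>\<eta> f g. (\<And>\<zeta>. f \<zeta> \<le> g \<zeta>) \<Longrightarrow> Q \<eta> f \<le> Q \<eta> g"
    and Q_cong: "\<And>\<eta> f g. \<eta> \<in> X \<Longrightarrow> (\<And>\<zeta>. \<zeta> \<in> X \<Longrightarrow> f \<zeta> = g \<zeta>) \<Longrightarrow> Q \<eta> f = Q \<eta> g"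
    and Q_add: "\<And>\<eta> f g. \<eta> \<in> X \<Longrightarrow> f \<in> borel_measurable S \<Longrightarrow> g \<in> borel_measurable S \<Longrightarrow>
      Q \<eta> (\<lambda>\<zeta>. f \<zeta> + g \<zeta>) = Q \<eta> f + Q \<eta> g"
    and Q_cmult: "\<And>\<eta> f c. \<eta> \<in> X \<Longrightarrow> f \<in> borel_measurable S \<Longrightarrow> Q \<eta> (\<lambda>\<zeta>. c * f \<zeta>) = c * Q \<eta> f"
    and Q_SUP: "\<And>\<eta> F. \<eta> \<in> X \<Longrightarrow> incseq F \<Longrightarrow> (\<And>n::nat. F n \<in> borel_measurable S) \<Longrightarrow>
      Q \<eta> (\<lambda>\<zeta>. SUP n. F n \<zeta>) = (SUP n. Q \<eta> (F n))"
    and Q_measurable: "\<And>F :: real \<Rightarrow> 's \<Rightarrow> ennreal. case_prod F \<in> borel_measurable (borel \<Otimes>\<^sub>M S) \<Longrightarrow>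
      (\<lambda>(t, \<eta>). Q \<eta> (F t)) \<in> borel_measurable (borel \<Otimes>\<^sub>M S)"
    and Q_bound: "\<And>\<eta>. \<eta> \<in> X \<Longrightarrow> Q \<eta> (\<lambda>_. 1) \<le> ennreal b"
begin

abbreviation q :: "'s \<Rightarrow> real" where "q \<equiv> exit_rate Q"

lemma Q_mono_on:
  assumes "\<eta> \<in> X" "\<And>\<zeta>. \<zeta> \<in> X \<Longrightarrow> f \<zeta> \<le> g \<zeta>"
  shows "Q \<eta> f \<le> Q \<eta> g"
proof -
  \<comment> \<open>Cutting \<open>f\<close> off outside \<open>X\<close> is invisible to
    \<open>Q \<eta>\<close> and makes the comparison hold everywhere, as \<open>Q_mono\<close>
    requires.\<close>
  have "Q \<eta> f = Q \<eta> (\<lambda>\<zeta>. if \<zeta> \<in> X then f \<zeta> else 0)"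
    using assms by (intro Q_cong) auto
  also have "\<dots> \<le> Q \<eta> g"
    using assms by (intro Q_mono) auto
  finally show ?thesis .
qed

lemma Q_one: "\<eta> \<in> X \<Longrightarrow> Q \<eta> (\<lambda>_. 1) = ennreal (q \<eta>)"
  using Q_bound[of \<eta>] by (auto simp: exit_rate_def less_top[symmetric]
      intro!: ennreal_enn2real[symmetric] le_less_trans[OF _ ennreal_less_top])

lemma q_nonneg [simp]: "0 \<le> q \<eta>"
  by (simp add: exit_rate_def)

lemma q_le: "\<eta> \<in> X \<Longrightarrow> q \<eta> \<le> b"
  using Q_bound[of \<eta>] b_nonneg by (simp add: Q_one)

lemma Q_const: "\<eta> \<in> X \<Longrightarrow> Q \<eta> (\<lambda>_. c) = c * ennreal (q \<eta>)"
  using Q_cmult[of \<eta> "\<lambda>_. 1" c] by (simp add: Q_one)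

lemma Q_measurable_fixed [measurable]:
  assumes "f \<in> borel_measurable S"
  shows "(\<lambda>\<eta>. Q \<eta> f) \<in> borel_measurable S"
proof -
  have "(\<lambda>(t::real, \<eta>). Q \<eta> f) \<in> borel_measurable (borel \<Otimes>\<^sub>M S)"
    using assms by (intro Q_measurable) simp
  from measurable_compose[OF _ this, of "\<lambda>\<eta>. (0, \<eta>)" S] show ?thesis
    by simp
qed

lemma q_measurable [measurable]: "q \<in> borel_measurable S"
  unfolding exit_rate_def by measurable

lemma Q_sum:
  assumes "\<eta> \<in> X" "\<And>i. f i \<in> borel_measurable S"
  shows "Q \<eta> (\<lambda>\<zeta>. \<Sum>i<n::nat. f i \<zeta>) = (\<Sum>i<n. Q \<eta> (f i))"
proof (induction n)
  case 0
  show ?case using Q_const[of \<eta> 0] assms by simp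
next
  case (Suc n)
  then show ?case using assms by (simp add: Q_add)
qed

lemma Q_suminf:
  assumes "\<eta> \<in> X" "\<And>i. f i \<in> borel_measurable S"
  shows "Q \<eta> (\<lambda>\<zeta>. \<Sum>i. f i \<zeta>) = (\<Sum>i. Q \<eta> (f i))"
proof -
  have "Q \<eta> (\<lambda>\<zeta>. SUP n. \<Sum>i<n. f i \<zeta>) = (SUP n. Q \<eta> (\<lambda>\<zeta>. \<Sum>i<n. f i \<zeta>))"
    using assms by (intro Q_SUP) (auto simp: incseq_def le_fun_def intro!: sum_mono2)
  then show ?thesis
    by (simp add: suminf_eq_SUP Q_sum[OF assms])
qed

section \<open>Feller's transition function: bounds, backward equation, additivity\<close>

lemma jump_prob_Suc_ge: "jump_prob Q n t \<eta> A \<le> jump_prob Q (Suc n) t \<eta> A"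
proof (induction n arbitrary: t \<eta>)
  case (Suc n)
  show ?case
    unfolding jump_prob.simps(2)[of Q "Suc n"] jump_prob.simps(2)[of Q n t]
    by (intro add_mono order_refl nn_integral_mono mult_right_mono mult_left_mono Q_mono Suc) auto
qed simp

lemma incseq_jump_prob: "incseq (\<lambda>n. jump_prob Q n t \<eta> A)"
  by (intro incseq_SucI jump_prob_Suc_ge)

text \<open>The upper limit depends on the parameter \<open>w\<close>; written as a condition on the
  pair \<open>(w, s)\<close>, the indicator is jointly measurable and Tonelli applies.\<close>

lemma set_nn_integral_Icc_measurable:
  fixes t :: "'a \<Rightarrow> real"
  assumes [measurable]: "case_prod F \<in> borel_measurable (N \<Otimes>\<^sub>M borel)" "t \<in> borel_measurable N"
  shows "(\<lambda>w. \<integral>\<^sup>+ s\<in>{0..t w}. F w s \<partial>lborel) \<in> borel_measurable N"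
proof -
  have "(\<lambda>w. \<integral>\<^sup>+ s\<in>{0..t w}. F w s \<partial>lborel) =
      (\<lambda>w. \<integral>\<^sup>+ s. F w s * (if 0 \<le> s \<and> s \<le> t w then 1 else 0) \<partial>lborel)"
    by (intro ext nn_integral_cong) (simp add: indicator_def)
  also have "\<dots> \<in> borel_measurable N"
  proof (rule lborel.borel_measurable_nn_integral)
    have "(\<lambda>w. F (fst w) (snd w) * (if 0 \<le> snd w \<and> snd w \<le> t (fst w) then 1 else 0))
        \<in> borel_measurable (N \<Otimes>\<^sub>M borel)"
      by measurable
    then show "(\<lambda>(w, s). F w s * (if 0 \<le> s \<and> s \<le> t w then 1 else 0))
        \<in> borel_measurable (N \<Otimes>\<^sub>M lborel)"
      by (simp add: case_prod_beta' cong: measurable_cong_sets sets_pair_measure_cong)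
  qed
  finally show ?thesis .
qed

lemma jump_prob_measurable:
  assumes [measurable]: "A \<in> sets S"
  shows "(\<lambda>(t, \<eta>). jump_prob Q n t \<eta> A) \<in> borel_measurable (borel \<Otimes>\<^sub>M S)"
proof (induction n)
  case 0
  show ?case by simp
next
  case (Suc n)
  have [measurable]: "(\<lambda>w. Q (snd (fst w)) (\<lambda>\<zeta>. jump_prob Q n (fst (fst w) - snd w) \<zeta> A))
      \<in> borel_measurable ((borel \<Otimes>\<^sub>M S) \<Otimes>\<^sub>M borel)"
    using measurable_compose[OF _ Q_measurable[OF Suc],
        of "\<lambda>w. (fst (fst w) - snd w, snd (fst w))" "(borel \<Otimes>\<^sub>M S) \<Otimes>\<^sub>M borel"]
    by simp
  have "(\<lambda>w. ennreal (exp (- q (snd w) * fst w)) * indicator A (snd w) +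
      (\<integral>\<^sup>+ s\<in>{0..fst w}. ennreal (exp (- q (snd w) * s)) *
        Q (snd w) (\<lambda>\<zeta>. jump_prob Q n (fst w - s) \<zeta> A) \<partial>lborel)) \<in> borel_measurable (borel \<Otimes>\<^sub>M S)"
    by (intro borel_measurable_add set_nn_integral_Icc_measurable) measurable
  then show ?case
    by (simp add: case_prod_beta')
qed

text \<open>By induction the integrand is at most the density
  \<open>q \<eta> * exp (- q \<eta> * s)\<close> of the first jump time. Its integral up to
  \<open>t\<close> is \<open>1 - exp (- q \<eta> * t)\<close>, exactly what the no-jump term leaves
  to 1.\<close>

lemma jump_prob_le_1:
  assumes "\<eta> \<in> X" "0 \<le> t"
  shows "jump_prob Q n t \<eta> A \<le> 1"
  using assms
proof (induction n arbitrary: t \<eta>)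
  case 0
  then show ?case
    by (auto simp: indicator_def mult_nonneg_nonneg intro!: mult_nonneg_nonneg)
next
  case (Suc n)
  have "(\<integral>\<^sup>+ s\<in>{0..t}. ennreal (exp (- q \<eta> * s)) * Q \<eta> (\<lambda>\<zeta>. jump_prob Q n (t - s) \<zeta> A) \<partial>lborel)
     \<le> (\<integral>\<^sup>+ s. ennreal (exp (- q \<eta> * s) * q \<eta>) * indicator {0..t} s \<partial>lborel)"
  proof (intro nn_integral_mono)
    fix s :: real
    have "Q \<eta> (\<lambda>\<zeta>. jump_prob Q n (t - s) \<zeta> A) \<le> Q \<eta> (\<lambda>_. 1)" if "s \<le> t"
      using Suc that by (intro Q_mono_on) auto
    then show "ennreal (exp (- q \<eta> * s)) * Q \<eta> (\<lambda>\<zeta>. jump_prob Q n (t - s) \<zeta> A) * indicator {0..t} s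
        \<le> ennreal (exp (- q \<eta> * s) * q \<eta>) * indicator {0..t} s"
      using Suc.prems by (auto simp: indicator_def Q_one ennreal_mult intro!: mult_left_mono)
  qed
  also have "\<dots> = ennreal (- exp (- q \<eta> * t) - (- exp (- q \<eta> * 0)))"
    using \<open>0 \<le> t\<close>
    by (intro nn_integral_FTC_Icc) (auto intro!: derivative_eq_intros)
  finally have "jump_prob Q (Suc n) t \<eta> A
      \<le> ennreal (exp (- q \<eta> * t)) + ennreal (1 - exp (- q \<eta> * t))"
    unfolding jump_prob.simps by (intro add_mono) (auto simp: indicator_def)
  also have "\<dots> = 1"
    using \<open>0 \<le> t\<close> by (subst ennreal_plus[symmetric]) auto
  finally show ?case .
qed

definition trans_prob :: "'s set \<Rightarrow> real \<Rightarrow> 's \<Rightarrow> ennreal" where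
  "trans_prob A t \<eta> = (SUP n. jump_prob Q n t \<eta> A)"

lemma trans_measurable_pair:
  assumes "A \<in> sets S"
  shows "case_prod (trans_prob A) \<in> borel_measurable (borel \<Otimes>\<^sub>M S)"
  using borel_measurable_SUP[OF _ jump_prob_measurable[OF assms], of UNIV "\<lambda>n. n"]
  by (simp add: trans_prob_def case_prod_beta')

lemma trans_measurable [measurable]:
  assumes "A \<in> sets S"
  shows "trans_prob A t \<in> borel_measurable S"
  using measurable_compose[OF _ trans_measurable_pair[OF assms], of "\<lambda>\<eta>. (t, \<eta>)" S] by simp

lemma Q_trans_measurable [measurable]:
  assumes "A \<in> sets S" "\<eta> \<in> space S"
  shows "(\<lambda>t. Q \<eta> (trans_prob A t)) \<in> borel_measurable borel"
  using measurable_compose[OF _ Q_measurable[OF trans_measurable_pair[OF assms(1)]],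
      of "\<lambda>t. (t, \<eta>)" borel] assms(2) by simp

lemma trans_le_1: "\<eta> \<in> X \<Longrightarrow> 0 \<le> t \<Longrightarrow> trans_prob A t \<eta> \<le> 1"
  unfolding trans_prob_def by (intro SUP_least jump_prob_le_1)

text \<open>Let \<open>n\<close> tend to infinity in the recursion: monotone convergence handles the
  time integral and \<open>Q_SUP\<close> the rates. This fixed point equation is what the analysis
  in time below starts from.\<close>

lemma trans_backward_eq:
  assumes A: "A \<in> sets S" and \<eta>: "\<eta> \<in> X"
  shows "trans_prob A t \<eta> = ennreal (exp (- q \<eta> * t)) * indicator A \<eta> +
     (\<integral>\<^sup>+ s\<in>{0..t}. ennreal (exp (- q \<eta> * s)) * Q \<eta> (trans_prob A (t - s)) \<partial>lborel)"
proof -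
  have \<eta>S: "\<eta> \<in> space S" using \<eta> X_space by auto
  have pm: "(\<lambda>\<zeta>. jump_prob Q n t \<zeta> A) \<in> borel_measurable S" for n t
    using measurable_compose[OF _ jump_prob_measurable[OF A, of n], of "\<lambda>\<eta>. (t, \<eta>)" S] by simp
  have [measurable]: "(\<lambda>s. Q \<eta> (\<lambda>\<zeta>. jump_prob Q n (t - s) \<zeta> A)) \<in> borel_measurable borel" for n
    using measurable_compose[OF _ Q_measurable[OF jump_prob_measurable[OF A, of n]],
      of "\<lambda>s. (t - s, \<eta>)" borel] \<eta>S by simp
  let ?I = "\<lambda>n s. ennreal (exp (- q \<eta> * s)) * Q \<eta> (\<lambda>\<zeta>. jump_prob Q n (t - s) \<zeta> A) * indicator {0..t} s"
  have inc: "incseq ?I"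
    by (auto simp: incseq_def le_fun_def intro!: mult_right_mono mult_left_mono Q_mono
        incseqD[OF incseq_jump_prob])
  have "trans_prob A t \<eta> = (SUP n. jump_prob Q (Suc n) t \<eta> A)"
    unfolding trans_prob_def
    by (rule LIMSEQ_unique[OF LIMSEQ_Suc[OF LIMSEQ_SUP[OF incseq_jump_prob]] LIMSEQ_SUP])
       (intro incseq_SucI jump_prob_Suc_ge)
  also have "\<dots> = (SUP n. ennreal (exp (- q \<eta> * t)) * indicator A \<eta> + (\<integral>\<^sup>+ s. ?I n s \<partial>lborel))"
    by simp
  also have "\<dots> = ennreal (exp (- q \<eta> * t)) * indicator A \<eta> + (SUP n. \<integral>\<^sup>+ s. ?I n s \<partial>lborel)"
    by (rule ennreal_SUP_add_right[symmetric]) auto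
  also have "(SUP n. \<integral>\<^sup>+ s. ?I n s \<partial>lborel) = (\<integral>\<^sup>+ s. (SUP n. ?I n s) \<partial>lborel)"
    by (intro nn_integral_monotone_convergence_SUP[symmetric] inc) measurable
  also have "\<dots> = (\<integral>\<^sup>+ s\<in>{0..t}. ennreal (exp (- q \<eta> * s)) * Q \<eta> (trans_prob A (t - s)) \<partial>lborel)"
  proof (intro nn_integral_cong)
    fix s
    have "Q \<eta> (trans_prob A (t - s)) = (SUP n. Q \<eta> (\<lambda>\<zeta>. jump_prob Q n (t - s) \<zeta> A))"
      unfolding trans_prob_def
      using \<eta> pm incseq_jump_prob by (intro Q_SUP) (auto simp: incseq_def le_fun_def)
    then show "(SUP n. ?I n s) = ennreal (exp (- q \<eta> * s)) * Q \<eta> (trans_prob A (t - s)) * indicator {0..t} s"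
      by (simp add: SUP_mult_left_ennreal SUP_mult_right_ennreal)
  qed
  finally show ?thesis .
qed

lemma trans_0: "A \<in> sets S \<Longrightarrow> \<eta> \<in> X \<Longrightarrow> trans_prob A 0 \<eta> = indicator A \<eta>"
proof -
  assume *: "A \<in> sets S" "\<eta> \<in> X"
  have "(\<integral>\<^sup>+ s\<in>{0..(0::real)}. ennreal (exp (- q \<eta> * s)) * Q \<eta> (trans_prob A (0 - s)) \<partial>lborel) =
     (\<integral>\<^sup>+ (s::real). 0 \<partial>lborel)"
    by (intro nn_integral_cong_AE) (use AE_lborel_singleton[of 0] in \<open>auto elim!: eventually_mono\<close>)
  then show ?thesis
    using trans_backward_eq[OF *, of 0] by simp
qed

text \<open>For each bound on the number of jumps, additivity follows by induction; the supremum
  over that bound may be exchanged with the sum because the terms increase. The result is needed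
  since \<open>measure_of\<close>, used in \<open>jump_law\<close>, returns the prescribed values
  only for a countably additive set function.\<close>

lemma trans_suminf:
  assumes A: "range A \<subseteq> sets S" "disjoint_family A" and \<eta>: "\<eta> \<in> X"
  shows "(\<Sum>i. trans_prob (A i) t \<eta>) = trans_prob (\<Union>i. A i) t \<eta>"
proof -
  have pm: "(\<lambda>\<zeta>. jump_prob Q n t \<zeta> (A i)) \<in> borel_measurable S" for n t i
    using measurable_compose[OF _ jump_prob_measurable[of "A i" n], of "\<lambda>\<eta>. (t, \<eta>)" S] A by auto
  have "(\<Sum>i. jump_prob Q n t \<eta> (A i)) = jump_prob Q n t \<eta> (\<Union>i. A i)" for n
    using \<eta>
  proof (induction n arbitrary: t \<eta>)
    case 0
    then show ?case
      using suminf_indicator[OF A(2), symmetric] by simp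
  next
    case (Suc n)
    have \<eta>S: "\<eta> \<in> space S" using Suc.prems X_space by auto
    have [measurable]: "(\<lambda>s. Q \<eta> (\<lambda>\<zeta>. jump_prob Q n (t - s) \<zeta> (A i))) \<in> borel_measurable borel" for i
      using measurable_compose[OF _ Q_measurable[OF jump_prob_measurable[of "A i" n]],
        of "\<lambda>s. (t - s, \<eta>)" borel] \<eta>S A by auto
    have "Q \<eta> (\<lambda>\<zeta>. jump_prob Q n (t - s) \<zeta> (\<Union>i. A i)) =
        (\<Sum>i. Q \<eta> (\<lambda>\<zeta>. jump_prob Q n (t - s) \<zeta> (A i)))" for s
    proof -
      have "Q \<eta> (\<lambda>\<zeta>. jump_prob Q n (t - s) \<zeta> (\<Union>i. A i)) =
          Q \<eta> (\<lambda>\<zeta>. \<Sum>i. jump_prob Q n (t - s) \<zeta> (A i))"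
        using Suc.prems by (intro Q_cong) (simp_all add: Suc.IH)
      then show ?thesis
        using Suc.prems pm by (simp add: Q_suminf)
    qed
    then have "(\<integral>\<^sup>+ s\<in>{0..t}. ennreal (exp (- q \<eta> * s)) *
          Q \<eta> (\<lambda>\<zeta>. jump_prob Q n (t - s) \<zeta> (\<Union>i. A i)) \<partial>lborel) =
        (\<integral>\<^sup>+ s. (\<Sum>i. ennreal (exp (- q \<eta> * s)) *
          Q \<eta> (\<lambda>\<zeta>. jump_prob Q n (t - s) \<zeta> (A i)) * indicator {0..t} s) \<partial>lborel)"
      by simp
    also have "\<dots> = (\<Sum>i. \<integral>\<^sup>+ s\<in>{0..t}. ennreal (exp (- q \<eta> * s)) *
          Q \<eta> (\<lambda>\<zeta>. jump_prob Q n (t - s) \<zeta> (A i)) \<partial>lborel)"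
      by (intro nn_integral_suminf) measurable
    finally show ?case
      using suminf_indicator[OF A(2), symmetric]
      by (simp add: suminf_add[OF summableI summableI, symmetric])
  qed
  moreover have "(\<Sum>i. SUP n. jump_prob Q n t \<eta> (A i)) = (SUP n. \<Sum>i. jump_prob Q n t \<eta> (A i))"
  proof (rule ennreal_suminf_SUP_eq_directed)
    fix N :: "nat set" and n m :: nat
    show "\<exists>k\<in>UNIV. \<forall>i\<in>N. jump_prob Q n t \<eta> (A i) \<le> jump_prob Q k t \<eta> (A i) \<and>
        jump_prob Q m t \<eta> (A i) \<le> jump_prob Q k t \<eta> (A i)"
      by (intro bexI[of _ "max n m"]) (auto intro: incseqD[OF incseq_jump_prob])
  qed
  ultimately show ?thesis
    by (simp add: trans_prob_def)
qed

lemma emeasure_jump_law: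
  assumes "\<eta> \<in> X" "A \<in> sets S"
  shows "emeasure (jump_law S Q \<eta> t) A = trans_prob A t \<eta>"
proof -
  have "emeasure (jump_law S Q \<eta> t) A = (SUP n. jump_prob Q n t \<eta> A)"
  proof (rule emeasure_measure_of[OF jump_law_def])
    show "countably_additive (sets (jump_law S Q \<eta> t)) (\<lambda>A. SUP n. jump_prob Q n t \<eta> A)"
      using trans_suminf[OF _ _ \<open>\<eta> \<in> X\<close>]
      by (auto simp: countably_additive_def trans_prob_def jump_law_def)
    have "jump_prob Q n t \<eta> {} = 0" for n
      using \<open>\<eta> \<in> X\<close>
    proof (induction n arbitrary: t \<eta>)
      case (Suc n)
      have "Q \<eta> (\<lambda>\<zeta>. jump_prob Q n s \<zeta> {}) = Q \<eta> (\<lambda>_. 0)" for s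
        using Suc by (intro Q_cong) auto
      then show ?case
        using Q_const[OF Suc.prems, of 0] by simp
    qed simp
    then show "positive (sets (jump_law S Q \<eta> t)) (\<lambda>A. SUP n. jump_prob Q n t \<eta> A)"
      by (simp add: positive_def)
  qed (use assms sets.sets_into_space in \<open>auto simp: jump_law_def\<close>)
  then show ?thesis
    by (simp add: trans_prob_def)
qed

text \<open>A one-step equation that bypasses the semigroup property. After the substitution of
  \<open>t - s\<close> for \<open>s\<close>, the backward equation puts the weight
  \<open>exp (- q \<eta> * (t - s))\<close> on \<open>trans_prob A s\<close>; going from
  \<open>t\<close> to \<open>t + h\<close> multiplies all that was accumulated up to
  \<open>t\<close> by \<open>exp (- q \<eta> * h)\<close> and adds the integral over the new
  interval.\<close>

lemma trans_shift:
  assumes A: "A \<in> sets S" and \<eta>: "\<eta> \<in> X" and "0 \<le> t" "0 \<le> h"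
  shows "trans_prob A (t + h) \<eta> = ennreal (exp (- q \<eta> * h)) * trans_prob A t \<eta> +
     (\<integral>\<^sup>+ s\<in>{t<..t + h}. ennreal (exp (- q \<eta> * (t + h - s))) * Q \<eta> (trans_prob A s) \<partial>lborel)"
proof -
  have [measurable]: "(\<lambda>t. Q \<eta> (trans_prob A t)) \<in> borel_measurable borel"
    using A \<eta> X_space by (intro Q_trans_measurable) auto
  have reflect: "(\<integral>\<^sup>+ s\<in>{0..t}. ennreal (exp (- q \<eta> * s)) * Q \<eta> (trans_prob A (t - s)) \<partial>lborel) =
     (\<integral>\<^sup>+ s\<in>{0..t}. ennreal (exp (- q \<eta> * (t - s))) * Q \<eta> (trans_prob A s) \<partial>lborel)" for t
    by (subst nn_integral_real_affine[where c = "-1" and t = t])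
       (auto intro!: nn_integral_cong simp: indicator_def)
  have split: "ennreal (exp (- q \<eta> * (t + h - s))) =
      ennreal (exp (- q \<eta> * h)) * ennreal (exp (- q \<eta> * (t - s)))" for s
    by (simp add: ennreal_mult[symmetric] exp_add[symmetric] algebra_simps)
  have split0: "ennreal (exp (- q \<eta> * (t + h))) =
      ennreal (exp (- q \<eta> * h)) * ennreal (exp (- q \<eta> * t))"
    using split[of 0] by simp
  have "(\<integral>\<^sup>+ s\<in>{0..t + h}. ennreal (exp (- q \<eta> * (t + h - s))) * Q \<eta> (trans_prob A s) \<partial>lborel) =
     (\<integral>\<^sup>+ s. ennreal (exp (- q \<eta> * h)) *
         (ennreal (exp (- q \<eta> * (t - s))) * Q \<eta> (trans_prob A s) * indicator {0..t} s) +
       ennreal (exp (- q \<eta> * (t + h - s))) * Q \<eta> (trans_prob A s) * indicator {t<..t + h} s \<partial>lborel)"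
  proof (intro nn_integral_cong)
    fix s
    show "ennreal (exp (- q \<eta> * (t + h - s))) * Q \<eta> (trans_prob A s) * indicator {0..t + h} s =
       ennreal (exp (- q \<eta> * h)) *
         (ennreal (exp (- q \<eta> * (t - s))) * Q \<eta> (trans_prob A s) * indicator {0..t} s) +
       ennreal (exp (- q \<eta> * (t + h - s))) * Q \<eta> (trans_prob A s) * indicator {t<..t + h} s"
      using assms split[of s] by (cases "s \<le> t") (auto simp: indicator_def mult.assoc)
  qed
  also have "\<dots> = ennreal (exp (- q \<eta> * h)) *
         (\<integral>\<^sup>+ s\<in>{0..t}. ennreal (exp (- q \<eta> * (t - s))) * Q \<eta> (trans_prob A s) \<partial>lborel) +
       (\<integral>\<^sup>+ s\<in>{t<..t + h}. ennreal (exp (- q \<eta> * (t + h - s))) * Q \<eta> (trans_prob A s) \<partial>lborel)"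
    by (subst nn_integral_add) (auto simp: nn_integral_cmult)
  finally show ?thesis
    unfolding trans_backward_eq[OF A \<eta>] reflect split0
    by (simp only: distrib_left add.assoc mult.assoc)
qed

text \<open>Truncating at 1 changes nothing on \<open>X\<close> and makes the function bounded everywhere.\<close>

definition rtrans :: "'s set \<Rightarrow> real \<Rightarrow> 's \<Rightarrow> real" where
  "rtrans A t \<eta> = min 1 (enn2real (trans_prob A t \<eta>))"

text \<open>\<open>K f \<eta> - q \<eta> * f \<eta>\<close> is the generator applied to
  \<open>f\<close>, the integral of \<open>f \<zeta> - f \<eta>\<close> against the jump rates out
  of \<eta>, for \<eta> in \<open>X\<close> and \<open>f\<close> with values in [0, 1].\<close>

definition K :: "('s \<Rightarrow> real) \<Rightarrow> 's \<Rightarrow> real" where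
  "K f \<eta> = enn2real (Q \<eta> (\<lambda>\<zeta>. ennreal (f \<zeta>)))"

lemma rtrans_bounds: "0 \<le> rtrans A t \<eta>" "rtrans A t \<eta> \<le> 1"
  by (auto simp: rtrans_def)

lemma rtrans_measurable [measurable]:
  assumes [measurable]: "A \<in> sets S"
  shows "rtrans A t \<in> borel_measurable S"
  unfolding rtrans_def by (intro borel_measurable_min) simp_all

lemma trans_eq_rtrans:
  assumes "\<eta> \<in> X" "0 \<le> t"
  shows "trans_prob A t \<eta> = ennreal (rtrans A t \<eta>)"
proof -
  have le: "trans_prob A t \<eta> \<le> 1"
    using assms by (rule trans_le_1)
  then have "enn2real (trans_prob A t \<eta>) \<le> 1"
    using enn2real_mono[OF le] by simp
  then show ?thesis
    using le_less_trans[OF le] by (simp add: rtrans_def)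
qed

lemma Q_eq_K:
  assumes "\<eta> \<in> X" "\<And>\<zeta>. \<zeta> \<in> X \<Longrightarrow> f \<zeta> \<le> 1"
  shows "Q \<eta> (\<lambda>\<zeta>. ennreal (f \<zeta>)) = ennreal (K f \<eta>)" "K f \<eta> \<le> q \<eta>"
proof -
  have *: "Q \<eta> (\<lambda>\<zeta>. ennreal (f \<zeta>)) \<le> ennreal (q \<eta>)"
    using assms Q_mono_on[of \<eta> "\<lambda>\<zeta>. ennreal (f \<zeta>)" "\<lambda>_. 1"] by (simp add: Q_one)
  then show "Q \<eta> (\<lambda>\<zeta>. ennreal (f \<zeta>)) = ennreal (K f \<eta>)"
    unfolding K_def by (intro ennreal_enn2real[symmetric] le_less_trans[OF * ennreal_less_top])
  then show "K f \<eta> \<le> q \<eta>"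
    using * by simp
qed

lemma K_nonneg [simp]: "0 \<le> K f \<eta>"
  by (simp add: K_def)

lemma K_measurable [measurable]: "f \<in> borel_measurable S \<Longrightarrow> K f \<in> borel_measurable S"
  unfolding K_def by measurable

lemma Q_trans_eq:
  assumes "\<eta> \<in> X" "0 \<le> t"
  shows "Q \<eta> (trans_prob A t) = ennreal (K (rtrans A t) \<eta>)"
proof -
  have "Q \<eta> (trans_prob A t) = Q \<eta> (\<lambda>\<zeta>. ennreal (rtrans A t \<zeta>))"
    using assms by (intro Q_cong) (simp_all add: trans_eq_rtrans)
  then show ?thesis
    using assms by (simp add: Q_eq_K rtrans_bounds)
qed

lemma rtrans_0: "A \<in> sets S \<Longrightarrow> \<eta> \<in> X \<Longrightarrow> rtrans A 0 \<eta> = indicator A \<eta>"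
  by (auto simp: rtrans_def trans_0 indicator_def)

section \<open>Short-time expansion of the transition function\<close>

lemma rtrans_upper:
  assumes A: "A \<in> sets S" and \<eta>: "\<eta> \<in> X" and "0 \<le> t" "0 \<le> h" "0 \<le> c"
    and c: "\<And>s. t \<le> s \<Longrightarrow> s \<le> t + h \<Longrightarrow> K (rtrans A s) \<eta> \<le> c"
  shows "rtrans A (t + h) \<eta> \<le> exp (- q \<eta> * h) * rtrans A t \<eta> + c * h"
proof -
  have "(\<integral>\<^sup>+ s\<in>{t<..t + h}. ennreal (exp (- q \<eta> * (t + h - s))) * Q \<eta> (trans_prob A s) \<partial>lborel)
      \<le> (\<integral>\<^sup>+ s. ennreal c * indicator {t<..t + h} s \<partial>lborel)"
  proof (intro nn_integral_mono)
    fix s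
    have "ennreal (exp (- q \<eta> * (t + h - s))) * Q \<eta> (trans_prob A s) \<le> ennreal c"
      if s: "t < s" "s \<le> t + h"
    proof -
      have "exp (- q \<eta> * (t + h - s)) * K (rtrans A s) \<eta> \<le> 1 * c"
        using s by (intro mult_mono c) auto
      then have "ennreal (exp (- q \<eta> * (t + h - s)) * K (rtrans A s) \<eta>) \<le> ennreal c"
        by (intro ennreal_leI) simp
      then show ?thesis
        using s assms(3) by (simp add: Q_trans_eq[OF \<eta>] ennreal_mult)
    qed
    then show "ennreal (exp (- q \<eta> * (t + h - s))) * Q \<eta> (trans_prob A s) * indicator {t<..t + h} s
        \<le> ennreal c * indicator {t<..t + h} s"
      by (simp add: indicator_def)
  qed
  also have "\<dots> = ennreal (c * h)"
    using assms(3-5) by (simp add: nn_integral_cmult_indicator ennreal_mult)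
  finally have *: "trans_prob A (t + h) \<eta> \<le> ennreal (exp (- q \<eta> * h)) * trans_prob A t \<eta> + ennreal (c * h)"
    unfolding trans_shift[OF A \<eta> \<open>0 \<le> t\<close> \<open>0 \<le> h\<close>] by (intro add_left_mono)
  then show ?thesis
  proof -
    have "ennreal (rtrans A (t + h) \<eta>)
        \<le> ennreal (exp (- q \<eta> * h) * rtrans A t \<eta> + c * h)"
      using assms(3-5) *
      by (simp add: trans_eq_rtrans[OF \<eta>] rtrans_bounds ennreal_mult)
    then show ?thesis
      using assms(4,5) by (subst (asm) ennreal_le_iff) (simp_all add: rtrans_bounds)
  qed
qed

text \<open>As in \<open>rtrans_upper\<close>, the exponential weight in \<open>trans_shift\<close>
  lies between \<open>exp (- q \<eta> * h)\<close> and 1, so a one-sided bound on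
  \<open>K (rtrans A s) \<eta>\<close> over the interval becomes a one-sided bound at time
  \<open>t + h\<close>.\<close>

lemma rtrans_lower:
  assumes A: "A \<in> sets S" and \<eta>: "\<eta> \<in> X" and "0 \<le> t" "0 \<le> h" "0 \<le> c"
    and c: "\<And>s. t \<le> s \<Longrightarrow> s \<le> t + h \<Longrightarrow> c \<le> K (rtrans A s) \<eta>"
  shows "exp (- q \<eta> * h) * rtrans A t \<eta> + exp (- q \<eta> * h) * c * h \<le> rtrans A (t + h) \<eta>"
proof -
  have "ennreal (exp (- q \<eta> * h) * c * h) =
      (\<integral>\<^sup>+ s. ennreal (exp (- q \<eta> * h) * c) * indicator {t<..t + h} s \<partial>lborel)"
    using assms(3-5) by (simp add: nn_integral_cmult_indicator ennreal_mult)
  also have "\<dots> \<le>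
      (\<integral>\<^sup>+ s\<in>{t<..t + h}. ennreal (exp (- q \<eta> * (t + h - s))) * Q \<eta> (trans_prob A s) \<partial>lborel)"
  proof (intro nn_integral_mono)
    fix s
    have "ennreal (exp (- q \<eta> * h) * c) \<le> ennreal (exp (- q \<eta> * (t + h - s))) * Q \<eta> (trans_prob A s)"
      if s: "t < s" "s \<le> t + h"
    proof -
      have "q \<eta> * (t + h - s) \<le> q \<eta> * h"
        using s by (intro mult_left_mono) auto
      then have "exp (- q \<eta> * h) * c \<le> exp (- q \<eta> * (t + h - s)) * K (rtrans A s) \<eta>"
        using s assms(4,5) by (intro mult_mono c) auto
      then have "ennreal (exp (- q \<eta> * h) * c)
          \<le> ennreal (exp (- q \<eta> * (t + h - s)) * K (rtrans A s) \<eta>)"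
        by (intro ennreal_leI)
      then show ?thesis
        using s assms(3) by (simp add: Q_trans_eq[OF \<eta>] ennreal_mult)
    qed
    then show "ennreal (exp (- q \<eta> * h) * c) * indicator {t<..t + h} s
        \<le> ennreal (exp (- q \<eta> * (t + h - s))) * Q \<eta> (trans_prob A s) * indicator {t<..t + h} s"
      by (simp add: indicator_def)
  qed
  finally have *: "ennreal (exp (- q \<eta> * h)) * trans_prob A t \<eta> + ennreal (exp (- q \<eta> * h) * c * h)
      \<le> trans_prob A (t + h) \<eta>"
    unfolding trans_shift[OF A \<eta> \<open>0 \<le> t\<close> \<open>0 \<le> h\<close>] by (intro add_left_mono)
  then show ?thesis
  proof -
    have "ennreal (exp (- q \<eta> * h) * rtrans A t \<eta> + exp (- q \<eta> * h) * c * h)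
        \<le> ennreal (rtrans A (t + h) \<eta>)"
      using assms(3-5) *
      by (simp add: trans_eq_rtrans[OF \<eta>] rtrans_bounds ennreal_mult)
    then show ?thesis
      by (subst (asm) ennreal_le_iff) (simp_all add: rtrans_bounds)
  qed
qed

lemma K_le_add:
  assumes "\<eta> \<in> X" "f \<in> borel_measurable S" "g \<in> borel_measurable S"
    and f: "\<And>\<zeta>. f \<zeta> \<le> 1" and g: "\<And>\<zeta>. 0 \<le> g \<zeta>" "\<And>\<zeta>. g \<zeta> \<le> 1" and "0 \<le> c"
    and le: "\<And>\<zeta>. \<zeta> \<in> X \<Longrightarrow> f \<zeta> \<le> g \<zeta> + c"
  shows "K f \<eta> \<le> K g \<eta> + c * q \<eta>"
proof -
  have "Q \<eta> (\<lambda>\<zeta>. ennreal (f \<zeta>)) \<le> Q \<eta> (\<lambda>\<zeta>. ennreal (g \<zeta>) + ennreal c)"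
    using assms by (intro Q_mono_on) (auto simp: ennreal_plus[symmetric] simp del: ennreal_plus
        intro!: ennreal_leI)
  also have "\<dots> = Q \<eta> (\<lambda>\<zeta>. ennreal (g \<zeta>)) + ennreal c * ennreal (q \<eta>)"
    using assms by (subst Q_add) (auto simp: Q_const)
  finally have "ennreal (K f \<eta>) \<le> ennreal (K g \<eta> + c * q \<eta>)"
    using assms by (simp add: Q_eq_K f g ennreal_mult)
  then show ?thesis
    using \<open>0 \<le> c\<close> by (subst (asm) ennreal_le_iff) auto
qed

text \<open>The crude use of the one-sided bounds, with \<open>c = b\<close> above and
  \<open>c = 0\<close> below. Its point is uniformity over \<open>X\<close>, which lets it be fed
  back through \<open>K\<close> in \<open>rtrans_expansion\<close>.\<close>

lemma rtrans_lipschitz: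
  assumes "A \<in> sets S" "\<eta> \<in> X" "0 \<le> t" "0 \<le> h"
  shows "\<bar>rtrans A (t + h) \<eta> - rtrans A t \<eta>\<bar> \<le> b * h"
proof -
  have K: "K (rtrans A s) \<eta> \<le> b" for s
    using Q_eq_K(2)[of \<eta> "rtrans A s"] q_le[of \<eta>] assms rtrans_bounds[of A s] by force
  have qh: "q \<eta> * h \<le> b * h"
    using assms q_le by (intro mult_right_mono) auto
  have "rtrans A (t + h) \<eta> \<le> exp (- q \<eta> * h) * rtrans A t \<eta> + b * h"
    using assms K b_nonneg by (intro rtrans_upper) auto
  also have "exp (- q \<eta> * h) * rtrans A t \<eta> \<le> 1 * rtrans A t \<eta>"
    using assms by (intro mult_right_mono) (auto simp: rtrans_bounds)
  finally have 1: "rtrans A (t + h) \<eta> \<le> rtrans A t \<eta> + b * h"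
    by simp
  have "rtrans A t \<eta> - b * h \<le> rtrans A t \<eta> - q \<eta> * h * rtrans A t \<eta>"
    using qh mult_left_le[of "rtrans A t \<eta>" "q \<eta> * h"] rtrans_bounds[of A t \<eta>] assms by auto
  also have "\<dots> = (1 + - q \<eta> * h) * rtrans A t \<eta>"
    by (simp add: algebra_simps)
  also have "\<dots> \<le> exp (- q \<eta> * h) * rtrans A t \<eta>"
    using rtrans_bounds[of A t \<eta>] by (intro mult_right_mono exp_ge_add_one_self)
  also have "\<dots> \<le> rtrans A (t + h) \<eta>"
    using rtrans_lower[OF assms, of 0] by simp
  finally show ?thesis
    using 1 by (simp add: abs_le_iff)
qed

text \<open>A bootstrap: by the Lipschitz bound, \<open>K (rtrans A s) \<eta>\<close> changes by at
  most \<open>b\<^sup>2 * h\<close> while \<open>s\<close> runs from \<open>t\<close> to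
  \<open>t + h\<close>, which sharpens the constants in the one-sided bounds. This change times
  \<open>h\<close> is one half of the error; the other half comes from the exponential factor,
  through \<open>1 - x \<le> exp (- x) \<le> 1 - x + x\<^sup>2\<close> at
  \<open>x = q \<eta> * h\<close>.\<close>

lemma rtrans_expansion:
  assumes A: "A \<in> sets S" and \<eta>: "\<eta> \<in> X" and t: "0 \<le> t" and h: "0 \<le> h"
  shows "\<bar>rtrans A (t + h) \<eta> - rtrans A t \<eta> - h * (K (rtrans A t) \<eta> - q \<eta> * rtrans A t \<eta>)\<bar>
      \<le> 2 * b\<^sup>2 * h\<^sup>2"
proof -
  define v where "v = rtrans A t \<eta>"
  define g where "g = K (rtrans A t) \<eta>"
  define x where "x = q \<eta> * h"
  have v: "0 \<le> v" "v \<le> 1"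
    by (auto simp: v_def rtrans_bounds)
  have qb: "0 \<le> q \<eta>" "q \<eta> \<le> b"
    using \<eta> q_le by auto
  have g: "0 \<le> g" "g \<le> b"
    using Q_eq_K(2)[OF \<eta>, of "rtrans A t"] qb by (auto simp: g_def rtrans_bounds)
  have x: "0 \<le> x" "x \<le> b * h" "x\<^sup>2 \<le> b\<^sup>2 * h\<^sup>2"
    using qb h by (auto simp: x_def power_mult_distrib intro!: mult_right_mono power_mono)
  have K: "K (rtrans A s) \<eta> \<le> g + b\<^sup>2 * h" "g - b\<^sup>2 * h \<le> K (rtrans A s) \<eta>"
    if s: "t \<le> s" "s \<le> t + h" for s
  proof -
    have lip: "\<bar>rtrans A s \<zeta> - rtrans A t \<zeta>\<bar> \<le> b * h" if "\<zeta> \<in> X" for \<zeta>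
      using rtrans_lipschitz[OF A that t, of "s - t"] s mult_left_mono[of "s - t" h b] b_nonneg by simp
    have bh: "b * h * q \<eta> \<le> b\<^sup>2 * h"
      using qb h b_nonneg mult_left_mono[of "q \<eta>" b "b * h"] by (simp add: power2_eq_square mult_ac)
    have "K (rtrans A s) \<eta> \<le> g + b * h * q \<eta>"
      unfolding g_def using A \<eta> h b_nonneg lip
      by (intro K_le_add) (auto simp: rtrans_bounds abs_le_iff diff_le_eq add.commute)
    with bh show "K (rtrans A s) \<eta> \<le> g + b\<^sup>2 * h" by simp
    have "g \<le> K (rtrans A s) \<eta> + b * h * q \<eta>"
      unfolding g_def using A \<eta> h b_nonneg lip
      by (intro K_le_add) (auto simp: rtrans_bounds abs_le_iff diff_le_eq add.commute)
    with bh show "g - b\<^sup>2 * h \<le> K (rtrans A s) \<eta>" by simp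
  qed
  have "rtrans A (t + h) \<eta> \<le> exp (- x) * v + (g + b\<^sup>2 * h) * h"
    using rtrans_upper[OF A \<eta> t h _ K(1)] g h by (simp add: x_def v_def)
  also have "exp (- x) * v \<le> (1 - x + x\<^sup>2) * v"
    using v x by (intro mult_right_mono exp_minus_le_quadratic)
  also have "\<dots> \<le> v - x * v + b\<^sup>2 * h\<^sup>2"
    using v x mult_left_le[of v "x\<^sup>2"] by (simp add: algebra_simps)
  finally have upper: "rtrans A (t + h) \<eta> - v - h * (g - q \<eta> * v) \<le> 2 * b\<^sup>2 * h\<^sup>2"
    by (simp add: x_def algebra_simps power2_eq_square)
  \<comment> \<open>\<open>rtrans_lower\<close> asks for a nonnegative bound, whereas
    \<open>g - b\<^sup>2 * h\<close> may be negative.\<close>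
  define c where "c = max 0 (g - b\<^sup>2 * h)"
  have "0 \<le> b\<^sup>2 * h" using h by simp
  then have c: "0 \<le> c" "c \<le> b" "g - b\<^sup>2 * h \<le> c"
    using g b_nonneg by (auto simp: c_def)
  have "v + h * (g - q \<eta> * v) - 2 * b\<^sup>2 * h\<^sup>2 \<le> (1 - x) * v + (1 - x) * (c * h)"
  proof -
    have "x * (c * h) \<le> (b * h) * (b * h)"
      using c x h by (intro mult_mono mult_right_mono) auto
    moreover have "(g - b\<^sup>2 * h) * h \<le> c * h"
      using c h by (intro mult_right_mono) auto
    ultimately show ?thesis
      by (simp add: x_def algebra_simps power2_eq_square)
  qed
  also have "\<dots> \<le> exp (- x) * v + exp (- x) * (c * h)"
    using v c h exp_ge_add_one_self[of "- x"] by (intro add_mono mult_right_mono) auto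
  also have "\<dots> \<le> rtrans A (t + h) \<eta>"
    using rtrans_lower[OF A \<eta> t h, of c] c K(2) by (simp add: x_def v_def c_def mult.assoc)
  finally show ?thesis
    using upper by (simp add: abs_le_iff v_def g_def)
qed

end

section \<open>Variance decay under a Poincare inequality\<close>

text \<open>With L f = \<open>K f - q f\<close> for the generator, \<open>stationary\<close> says
  that L f has \<mu>-mean zero, in terms of nonnegative integrals so that no integrability is
  involved. The right-hand side of \<open>poincare\<close> is -\<integral> f L f d\<mu>; the
  inequality is demanded for \<open>f\<close> with values in [0, 1], the range of
  \<open>rtrans\<close>.\<close>

locale poincare_jump_rates = jump_rates S Q X b + prob_space \<mu>
  for S :: "'s measure" and Q X b and \<mu> :: "'s measure" and \<gamma> :: real +
  assumes sets_\<mu>: "sets \<mu> = sets S"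
    and AE_X: "AE \<eta> in \<mu>. \<eta> \<in> X"
    and \<gamma>_nonneg: "0 \<le> \<gamma>"
    and stationary: "\<And>f. f \<in> borel_measurable S \<Longrightarrow>
      (\<integral>\<^sup>+ \<eta>. Q \<eta> f \<partial>\<mu>) = (\<integral>\<^sup>+ \<eta>. ennreal (q \<eta>) * f \<eta> \<partial>\<mu>)"
    and poincare: "\<And>f :: 's \<Rightarrow> real. f \<in> borel_measurable S \<Longrightarrow> (\<And>\<eta>. 0 \<le> f \<eta>) \<Longrightarrow> (\<And>\<eta>. f \<eta> \<le> 1) \<Longrightarrow>
      \<gamma> * Var \<mu> f \<le> (LINT \<eta>|\<mu>. q \<eta> * (f \<eta>)\<^sup>2 - f \<eta> * K f \<eta>)"
begin

lemma measurable_\<mu> [measurable_cong, simp]: "sets \<mu> = sets S"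
  by (rule sets_\<mu>)

lemma integrable_bounded_on_X:
  fixes f :: "'s \<Rightarrow> real"
  assumes "f \<in> borel_measurable S" "\<And>\<eta>. \<eta> \<in> X \<Longrightarrow> \<bar>f \<eta>\<bar> \<le> B"
  shows "integrable \<mu> f"
  using assms AE_X by (intro integrable_const_bound[of _ B]) (auto elim: eventually_mono)

lemma integrable_rtrans:
  assumes "A \<in> sets S"
  shows "integrable \<mu> (rtrans A t)"
  using assms by (intro integrable_bounded_on_X[of _ 1]) (auto simp: rtrans_bounds)

lemma integrable_rtrans_sq:
  assumes "A \<in> sets S"
  shows "integrable \<mu> (\<lambda>\<eta>. (rtrans A t \<eta>)\<^sup>2)"
  using assms
  by (intro integrable_bounded_on_X[of _ 1]) (auto simp: rtrans_bounds power_le_one)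

lemma K_rtrans_bound: "\<eta> \<in> X \<Longrightarrow> \<bar>K (rtrans A t) \<eta>\<bar> \<le> b"
  using Q_eq_K(2)[of \<eta> "rtrans A t"] q_le[of \<eta>] rtrans_bounds[of A t] by force

lemma q_rtrans_bound: "\<eta> \<in> X \<Longrightarrow> \<bar>q \<eta> * rtrans A t \<eta>\<bar> \<le> b"
  using mult_mono[OF q_le[of \<eta>] rtrans_bounds(2)[of A t \<eta>]] b_nonneg rtrans_bounds[of A t]
  by (simp add: abs_mult)

lemma integral_K_rtrans:
  assumes [measurable]: "A \<in> sets S"
  shows "(LINT \<eta>|\<mu>. K (rtrans A t) \<eta>) = (LINT \<eta>|\<mu>. q \<eta> * rtrans A t \<eta>)"
proof -
  have "(\<integral>\<^sup>+ \<eta>. ennreal (K (rtrans A t) \<eta>) \<partial>\<mu>) = (\<integral>\<^sup>+ \<eta>. Q \<eta> (\<lambda>\<zeta>. ennreal (rtrans A t \<zeta>)) \<partial>\<mu>)"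
    using AE_X by (intro nn_integral_cong_AE) (auto simp: Q_eq_K rtrans_bounds elim!: eventually_mono)
  also have "\<dots> = (\<integral>\<^sup>+ \<eta>. ennreal (q \<eta> * rtrans A t \<eta>) \<partial>\<mu>)"
    by (subst stationary) (auto simp: ennreal_mult rtrans_bounds)
  finally show ?thesis
    by (subst (1 2) integral_eq_nn_integral) (auto simp: rtrans_bounds)
qed

text \<open>The first-order term of \<open>rtrans_expansion\<close> integrates to zero by
  stationarity, so the mean moves by O(h^2) in a step \<open>h\<close>. Then
  \<open>discrete_gronwall\<close> with \<open>a = 0\<close>, applied to the change of the mean and
  to its negative, shows that it does not move at all.\<close>

lemma mean_rtrans:
  assumes A[measurable]: "A \<in> sets S" and "0 \<le> T"
  shows "expectation (rtrans A T) = prob A"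
proof -
  let ?m = "\<lambda>t. expectation (rtrans A t)"
  have step: "\<bar>?m (t + h) - ?m t\<bar> \<le> 2 * b\<^sup>2 * h\<^sup>2" if th: "0 \<le> t" "0 \<le> h" for t h
  proof -
    let ?d = "\<lambda>\<eta>. rtrans A (t + h) \<eta> - rtrans A t \<eta> - h * (K (rtrans A t) \<eta> - q \<eta> * rtrans A t \<eta>)"
    have iK: "integrable \<mu> (K (rtrans A t))"
      by (rule integrable_bounded_on_X[OF _ K_rtrans_bound]) measurable
    have iq: "integrable \<mu> (\<lambda>\<eta>. q \<eta> * rtrans A t \<eta>)"
      by (rule integrable_bounded_on_X[OF _ q_rtrans_bound]) measurable
    have d: "?m (t + h) - ?m t = expectation ?d"
      using iK iq integrable_rtrans[OF A] by (simp add: integral_K_rtrans)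
    have "\<bar>expectation ?d\<bar> \<le> expectation (\<lambda>\<eta>. \<bar>?d \<eta>\<bar>)"
      by (rule integral_abs_bound)
    also have "\<dots> \<le> expectation (\<lambda>_. 2 * b\<^sup>2 * h\<^sup>2)"
    proof (rule integral_mono_AE)
      show "integrable \<mu> (\<lambda>\<eta>. \<bar>?d \<eta>\<bar>)"
        using iK iq integrable_rtrans[OF A] by simp
      show "AE \<eta> in \<mu>. \<bar>?d \<eta>\<bar> \<le> 2 * b\<^sup>2 * h\<^sup>2"
        using AE_X by eventually_elim (rule rtrans_expansion[OF A _ th])
    qed (rule integrable_const)
    also have "\<dots> = 2 * b\<^sup>2 * h\<^sup>2"
      by (simp add: prob_space)
    finally show ?thesis
      unfolding d .
  qed
  have "?m T - ?m 0 \<le> exp (- 0 * T) * (?m 0 - ?m 0)"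
  proof (rule discrete_gronwall[where \<phi> = "\<lambda>t. ?m t - ?m 0" and a = 0 and c = "2 * b\<^sup>2"])
    fix t h :: real assume "0 \<le> t" "0 \<le> h"
    from step[OF this] show "?m (t + h) - ?m 0 \<le> (1 - 0 * h) * (?m t - ?m 0) + (2 * b\<^sup>2) * h\<^sup>2"
      unfolding mult_zero_left diff_zero mult_1 by linarith
  qed (use \<open>0 \<le> T\<close> in simp_all)
  moreover have "?m 0 - ?m T \<le> exp (- 0 * T) * (?m 0 - ?m 0)"
  proof (rule discrete_gronwall[where \<phi> = "\<lambda>t. ?m 0 - ?m t" and a = 0 and c = "2 * b\<^sup>2"])
    fix t h :: real assume "0 \<le> t" "0 \<le> h"
    from step[OF this] show "?m 0 - ?m (t + h) \<le> (1 - 0 * h) * (?m 0 - ?m t) + (2 * b\<^sup>2) * h\<^sup>2"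
      unfolding mult_zero_left diff_zero mult_1 by linarith
  qed (use \<open>0 \<le> T\<close> in simp_all)
  moreover have "?m 0 = prob A"
  proof -
    have "?m 0 = expectation (indicator A)"
      using AE_X by (intro integral_cong_AE) (auto simp: rtrans_0 A elim!: eventually_mono)
    then show ?thesis by simp
  qed
  ultimately show ?thesis by simp
qed

lemma Var_rtrans:
  assumes "A \<in> sets S" "0 \<le> t"
  shows "Var \<mu> (rtrans A t) = expectation (\<lambda>\<eta>. (rtrans A t \<eta>)\<^sup>2) - (prob A)\<^sup>2"
  unfolding Var_def
  using variance_eq[OF integrable_rtrans[OF assms(1), of t] integrable_rtrans_sq[OF assms(1)]]
  by (simp add: mean_rtrans[OF assms])

text \<open>The mean being constant, only the second moment changes, and to first order its change
  is \<open>- 2 * h\<close> times the quadratic form in \<open>poincare\<close>. This is the source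
  of the factor 2 in the decay rate.\<close>

lemma Var_rtrans_step:
  assumes A[measurable]: "A \<in> sets S" and t: "0 \<le> t" and h: "0 \<le> h"
  shows "Var \<mu> (rtrans A (t + h)) \<le> (1 - 2 * \<gamma> * h) * Var \<mu> (rtrans A t) + 5 * b\<^sup>2 * h\<^sup>2"
proof -
  let ?v = "rtrans A t"
  let ?e = "\<lambda>\<eta>. q \<eta> * (?v \<eta>)\<^sup>2 - ?v \<eta> * K ?v \<eta>"
  have "\<bar>?e \<eta>\<bar> \<le> 2 * b" if "\<eta> \<in> X" for \<eta>
  proof -
    have "\<bar>?e \<eta>\<bar> = \<bar>?v \<eta>\<bar> * \<bar>q \<eta> * ?v \<eta> - K ?v \<eta>\<bar>"
      by (simp add: abs_mult[symmetric] algebra_simps power2_eq_square)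
    also have "\<dots> \<le> 1 * (2 * b)"
    proof (intro mult_mono)
      show "\<bar>q \<eta> * ?v \<eta> - K ?v \<eta>\<bar> \<le> 2 * b"
        using q_rtrans_bound[OF that, of A t] K_rtrans_bound[OF that, of A t] by linarith
    qed (auto simp: rtrans_bounds)
    finally show ?thesis by simp
  qed
  then have ie: "integrable \<mu> ?e"
    by (intro integrable_bounded_on_X[of _ "2 * b"]) auto
  have "expectation (\<lambda>\<eta>. (rtrans A (t + h) \<eta>)\<^sup>2)
      \<le> expectation (\<lambda>\<eta>. (?v \<eta>)\<^sup>2 - 2 * h * ?e \<eta> + 5 * b\<^sup>2 * h\<^sup>2)"
  proof (rule integral_mono_AE)
    show "AE \<eta> in \<mu>. (rtrans A (t + h) \<eta>)\<^sup>2 \<le> (?v \<eta>)\<^sup>2 - 2 * h * ?e \<eta> + 5 * b\<^sup>2 * h\<^sup>2"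
      using AE_X
    proof eventually_elim
      case (elim \<eta>)
      \<comment> \<open>\<open>l\<close> is the first-order part of the increment \<open>r\<close>.
        In (v + r)^2 = v^2 + 2 v l + 2 v (r - l) + r^2 the third term costs at most 4 b^2 h^2 and
        the last at most b^2 h^2, whence the constant 5.\<close>
      define l where "l = h * (K ?v \<eta> - q \<eta> * ?v \<eta>)"
      define r where "r = rtrans A (t + h) \<eta> - ?v \<eta>"
      have "r - l \<le> 2 * b\<^sup>2 * h\<^sup>2"
        using rtrans_expansion[OF A elim t h] by (simp add: l_def r_def abs_le_iff)
      then have "?v \<eta> * (r - l) \<le> ?v \<eta> * (2 * b\<^sup>2 * h\<^sup>2)"
        using rtrans_bounds(1) by (rule mult_left_mono)
      also have "\<dots> \<le> 1 * (2 * b\<^sup>2 * h\<^sup>2)"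
        using rtrans_bounds(2) by (rule mult_right_mono) simp
      finally have "?v \<eta> * (r - l) \<le> 1 * (2 * b\<^sup>2 * h\<^sup>2)" .
      moreover have "r\<^sup>2 \<le> (b * h)\<^sup>2"
        using rtrans_lipschitz[OF A elim t h] by (simp add: r_def abs_le_square_iff[symmetric] b_nonneg h)
      moreover have "(rtrans A (t + h) \<eta>)\<^sup>2 = (?v \<eta>)\<^sup>2 + 2 * (?v \<eta> * (r - l)) + 2 * (?v \<eta> * l) + r\<^sup>2"
        by (simp add: r_def power2_eq_square algebra_simps)
      moreover have "?v \<eta> * l = - (h * ?e \<eta>)"
        by (simp add: l_def power2_eq_square algebra_simps)
      ultimately show ?case
        by (simp add: power_mult_distrib)
    qed
  qed (intro integrable_rtrans_sq A Bochner_Integration.integrable_add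
      Bochner_Integration.integrable_diff integrable_mult_right ie integrable_const)+
  also have "\<dots> = expectation (\<lambda>\<eta>. (?v \<eta>)\<^sup>2) - 2 * h * expectation ?e + 5 * b\<^sup>2 * h\<^sup>2"
    using ie integrable_rtrans_sq[OF A, of t]
    by (subst Bochner_Integration.integral_add, simp, simp,
        subst Bochner_Integration.integral_diff, simp, simp) (simp add: prob_space)
  also have "\<dots> \<le> expectation (\<lambda>\<eta>. (?v \<eta>)\<^sup>2) - 2 * h * (\<gamma> * Var \<mu> ?v) + 5 * b\<^sup>2 * h\<^sup>2"
    using poincare[of ?v] h by (auto simp: rtrans_bounds intro!: mult_left_mono)
  finally show ?thesis
    using t h A by (simp add: Var_rtrans algebra_simps)
qed

lemma Var_rtrans_decay:
  assumes A: "A \<in> sets S" and "0 \<le> T"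
  shows "Var \<mu> (rtrans A T) \<le> exp (- (2 * \<gamma>) * T)"
proof -
  have "Var \<mu> (rtrans A T) \<le> exp (- (2 * \<gamma>) * T) * Var \<mu> (rtrans A 0)"
    using Var_rtrans_step[OF A] \<gamma>_nonneg \<open>0 \<le> T\<close>
    by (intro discrete_gronwall[of _ _ "5 * b\<^sup>2"]) (auto simp: Var_def)
  also have "Var \<mu> (rtrans A 0) \<le> 1"
  proof -
    have "Var \<mu> (rtrans A 0) \<le> expectation (\<lambda>\<eta>. (rtrans A 0 \<eta>)\<^sup>2)"
      using A by (simp add: Var_rtrans)
    also have "\<dots> \<le> expectation (\<lambda>_. 1)"
      using A by (intro integral_mono integrable_rtrans_sq) (auto simp: rtrans_bounds power_le_one)
    finally show ?thesis by (simp add: prob_space)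
  qed
  finally show ?thesis by simp
qed

text \<open>An atom of \<open>\<mu>\<close> turns the mean-square bound into a pointwise bound at the atom.\<close>

lemma jump_law_close:
  assumes A[measurable]: "A \<in> sets S" and "\<eta> \<in> X" "{\<eta>} \<in> sets S" "0 < prob {\<eta>}" "0 \<le> T"
  shows "\<bar>measure (jump_law S Q \<eta> T) A - prob A\<bar> \<le> exp (- \<gamma> * T) / sqrt (prob {\<eta>})"
proof -
  let ?v = "rtrans A T"
  have "prob {\<eta>} * (?v \<eta> - prob A)\<^sup>2 = expectation (\<lambda>\<zeta>. indicator {\<eta>} \<zeta> * (?v \<eta> - prob A)\<^sup>2)"
    using assms by simp
  also have "\<dots> \<le> expectation (\<lambda>\<zeta>. (?v \<zeta> - prob A)\<^sup>2)"
  proof (rule integral_mono)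
    have "\<bar>?v \<zeta> - prob A\<bar> \<le> 1" for \<zeta>
      using rtrans_bounds[of A T \<zeta>] prob_le_1[of A] measure_nonneg[of \<mu> A] by linarith
    then show "integrable \<mu> (\<lambda>\<zeta>. (?v \<zeta> - prob A)\<^sup>2)"
      by (intro integrable_bounded_on_X[of _ 1]) (auto simp: abs_square_le_1)
    show "integrable \<mu> (\<lambda>\<zeta>. indicator {\<eta>} \<zeta> * (?v \<eta> - prob A)\<^sup>2)"
      using assms by (intro integrable_mult_left) (simp add: less_top[symmetric])
  qed (auto simp: indicator_def)
  \<comment> \<open>By \<open>mean_rtrans\<close> the number \<open>prob A\<close> is the mean of
    \<open>?v\<close>, so this second moment is its variance.\<close>
  also have "\<dots> = Var \<mu> ?v"
    using assms by (simp add: Var_def mean_rtrans)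
  also have "\<dots> \<le> exp (2 * (- \<gamma> * T))"
    using Var_rtrans_decay[OF A \<open>0 \<le> T\<close>] by (simp add: mult.assoc)
  also have "\<dots> = (exp (- \<gamma> * T))\<^sup>2"
    by (rule exp_double)
  finally have "sqrt (prob {\<eta>} * (?v \<eta> - prob A)\<^sup>2) \<le> sqrt ((exp (- \<gamma> * T))\<^sup>2)"
    by (rule real_sqrt_le_mono)
  then have "sqrt (prob {\<eta>}) * \<bar>?v \<eta> - prob A\<bar> \<le> exp (- \<gamma> * T)"
    unfolding real_sqrt_mult real_sqrt_abs by simp
  then have "\<bar>?v \<eta> - prob A\<bar> \<le> exp (- \<gamma> * T) / sqrt (prob {\<eta>})"
    using \<open>0 < prob {\<eta>}\<close> by (subst pos_le_divide_eq) (simp_all add: mult.commute)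
  moreover have "measure (jump_law S Q \<eta> T) A = ?v \<eta>"
    unfolding measure_def emeasure_jump_law[OF \<open>\<eta> \<in> X\<close> A]
    using trans_eq_rtrans[OF \<open>\<eta> \<in> X\<close> \<open>0 \<le> T\<close>] by (simp add: rtrans_bounds)
  ultimately show ?thesis by simp
qed

end

subsection \<open>Measurability on the configuration space\<close>

lemma space_euclid: "space (euclid d) = PiE {..<d} (\<lambda>_. UNIV)"
  by (simp add: euclid_def space_PiM)

lemma sets_euclid: "sets (euclid d) = sets (Pi\<^sub>M {..<d} (\<lambda>_. borel))"
  unfolding euclid_def by (intro sets_PiM_cong) auto

lemma coord_measurable:
  assumes "i < d" and "f \<in> measurable N (euclid d)"
  shows "(\<lambda>w. f w i) \<in> borel_measurable N"
proof -
  have "(\<lambda>x. x i) \<in> borel_measurable (euclid d)"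
    using assms by (subst measurable_cong_sets[OF sets_euclid refl]) measurable
  from measurable_compose[OF assms(2) this] show ?thesis .
qed

lemma edist_measurable [measurable (raw)]:
  assumes "f \<in> measurable N (euclid d)" "g \<in> measurable N (euclid d)"
  shows "(\<lambda>w. edist d (f w) (g w)) \<in> borel_measurable N"
  unfolding edist_def L2_set_def
  using assms
  by (intro borel_measurable_sqrt[THEN measurable_compose[rotated]] borel_measurable_sum
      borel_measurable_power borel_measurable_diff coord_measurable) auto

lemma edist_self [simp]: "edist d x x = 0"
  by (simp add: edist_def L2_set_def)

lemma edist_commute: "edist d x y = edist d y x"
  unfolding edist_def L2_set_def by (simp add: power2_commute)

lemma euclid_eqI:
  assumes "x \<in> space (euclid d)" "y \<in> space (euclid d)" "\<And>i. i < d \<Longrightarrow> x i = y i"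
  shows "x = y"
  by (rule PiE_ext[OF assms(1,2)[unfolded space_euclid]]) (use assms(3) in auto)

lemma space_config_space: "space (config_space d) = configs d"
  unfolding config_space_def by (intro space_measure_of) auto

lemma sets_config_space:
  "sets (config_space d) = sigma_sets (configs d)
     {{\<eta> \<in> configs d. card (\<eta> \<inter> B) = k} | B k. B \<in> sets (euclid d)}"
  unfolding config_space_def by (intro sets_measure_of) auto

lemma configs_finite: "\<eta> \<in> configs d \<Longrightarrow> finite \<eta>"
  by (simp add: configs_def)

lemma measurable_config_spaceI:
  assumes "\<And>w. w \<in> space N \<Longrightarrow> f w \<in> configs d"
    and card: "\<And>B. B \<in> sets (euclid d) \<Longrightarrow> (\<lambda>w. card (f w \<inter> B)) \<in> measurable N (count_space UNIV)"
  shows "f \<in> measurable N (config_space d)"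
  unfolding config_space_def
proof (rule measurable_measure_of)
  fix A assume "A \<in> {{\<eta> \<in> configs d. card (\<eta> \<inter> B) = k} | B k. B \<in> sets (euclid d)}"
  then obtain B k where A: "A = {\<eta> \<in> configs d. card (\<eta> \<inter> B) = k}" and B: "B \<in> sets (euclid d)"
    by auto
  have "f -` A \<inter> space N = (\<lambda>w. card (f w \<inter> B)) -` {k} \<inter> space N"
    using assms(1) by (auto simp: A)
  then show "f -` A \<inter> space N \<in> sets N"
    using measurable_sets[OF card[OF B], of "{k}"] by simp
qed (use assms in auto)

lemma card_config_measurable [measurable]:
  assumes [measurable]: "F \<in> measurable N (config_space d)" and B: "B \<in> sets (euclid d)"
  shows "(\<lambda>w. card (F w \<inter> B)) \<in> measurable N (count_space UNIV)"
proof (rule measurable_compose[OF assms(1)])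
  show "(\<lambda>\<eta>. card (\<eta> \<inter> B)) \<in> measurable (config_space d) (count_space UNIV)"
  proof (subst measurable_count_space_eq2_countable, safe)
    fix k
    have "(\<lambda>\<eta>. card (\<eta> \<inter> B)) -` {k} \<inter> space (config_space d) =
        {\<eta> \<in> configs d. card (\<eta> \<inter> B) = k}"
      by (auto simp: space_config_space)
    also have "\<dots> \<in> sets (config_space d)"
      unfolding sets_config_space using B by (intro sigma_sets.Basic) blast
    finally show "(\<lambda>\<eta>. card (\<eta> \<inter> B)) -` {k} \<inter> space (config_space d) \<in> sets (config_space d)" .
  qed auto
qed

text \<open>Index of the cube of side 1/k containing \<open>x\<close>; for \<open>k = 0\<close>
  there is a single cell. There are only countably many indices. The cells serve twice: to make
  membership measurable, and to bound the cardinality of hard core configurations.\<close>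

definition cell :: "nat \<Rightarrow> nat \<Rightarrow> point \<Rightarrow> nat \<Rightarrow> int" where
  "cell d k x = restrict (\<lambda>i. \<lfloor>real k * x i\<rfloor>) {..<d}"

lemma cell_eq_iff: "cell d k x = cell d k y \<longleftrightarrow> (\<forall>i<d. \<lfloor>real k * x i\<rfloor> = \<lfloor>real k * y i\<rfloor>)"
  unfolding cell_def by (auto simp: restrict_def fun_eq_iff)

lemma cell_sets [measurable]: "{x \<in> space (euclid d). cell d k x = z} \<in> sets (euclid d)"
proof (cases "z \<in> extensional {..<d}")
  case True
  then have "{x \<in> space (euclid d). cell d k x = z} =
      {x \<in> space (euclid d). \<forall>i\<in>{..<d}. \<lfloor>real k * x i\<rfloor> = z i}"
    by (auto simp: cell_def fun_eq_iff extensional_def)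
  also have "\<dots> \<in> sets (euclid d)"
  proof (rule sets.sets_Collect_finite_All)
    fix i assume "i \<in> {..<d}"
    then have [measurable]: "(\<lambda>x. x i) \<in> borel_measurable (euclid d)"
      using coord_measurable[of i d "\<lambda>x. x" "euclid d"] by simp
    show "{x \<in> space (euclid d). \<lfloor>real k * x i\<rfloor> = z i} \<in> sets (euclid d)"
      by measurable
  qed simp
  finally show ?thesis .
next
  case False
  then have "{x \<in> space (euclid d). cell d k x = z} = {}"
    by (auto simp: cell_def)
  then show ?thesis by (simp only: sets.empty_sets)
qed

text \<open>Take a coordinate in which the points differ: once \<open>k\<close> exceeds the
  reciprocal of that difference, the scaled coordinates are more than 1 apart and have different
  floors.\<close>

lemma eventually_cell_neq:
  assumes "x \<in> space (euclid d)" "y \<in> space (euclid d)" "x \<noteq> y"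
  shows "\<forall>\<^sub>F k in sequentially. cell d k x \<noteq> cell d k y"
proof -
  obtain i where i: "i < d" "x i \<noteq> y i"
    using euclid_eqI assms by blast
  have "\<forall>\<^sub>F k in sequentially. 1 / \<bar>x i - y i\<bar> < real k"
    using filterlim_real_sequentially by (rule filterlim_at_top_dense[THEN iffD1, rule_format])
  then show ?thesis
  proof eventually_elim
    case (elim k)
    then have "1 < real k * \<bar>x i - y i\<bar>"
      using i by (simp add: pos_divide_less_eq)
    also have "\<dots> = \<bar>real k * x i - real k * y i\<bar>"
      by (metis abs_mult abs_of_nat right_diff_distrib)
    finally have "\<lfloor>real k * x i\<rfloor> \<noteq> \<lfloor>real k * y i\<rfloor>"
      by linarith
    then show ?case
      using i by (auto simp: cell_eq_iff)
  qed
qed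

text \<open>A finite configuration contains \<open>x\<close> iff it charges the cell of \<open>x\<close> at every scale; this makes
  membership a countable combination of counts.\<close>

lemma mem_config_iff:
  assumes "x \<in> space (euclid d)" "\<eta> \<in> configs d"
  shows "x \<in> \<eta> \<longleftrightarrow> (\<forall>k. \<exists>z\<in>PiE {..<d} (\<lambda>_. UNIV). cell d k x = z \<and>
      card (\<eta> \<inter> {y \<in> space (euclid d). cell d k y = z}) \<noteq> 0)" (is "_ \<longleftrightarrow> ?R")
proof
  assume "x \<in> \<eta>"
  then show ?R
    using assms by (force simp: configs_def cell_def)
next
  assume ?R
  show "x \<in> \<eta>"
  proof (rule ccontr)
    assume "x \<notin> \<eta>"
    then have "\<forall>y\<in>\<eta>. \<forall>\<^sub>F k in sequentially. cell d k x \<noteq> cell d k y"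
      using assms by (auto simp: configs_def intro!: eventually_cell_neq)
    then have "\<forall>\<^sub>F k in sequentially. \<forall>y\<in>\<eta>. cell d k x \<noteq> cell d k y"
      using assms by (intro eventually_ball_finite) (auto simp: configs_def)
    then obtain k where "\<forall>y\<in>\<eta>. cell d k x \<noteq> cell d k y"
      using eventually_happens' sequentially_bot by blast
    then have "\<eta> \<inter> {y \<in> space (euclid d). cell d k y = cell d k x} = {}"
      by auto
    with \<open>?R\<close> show False
      by (metis card.empty)
  qed
qed

lemma mem_config_measurable [measurable (raw)]:
  assumes [measurable]: "f \<in> measurable N (euclid d)" "F \<in> measurable N (config_space d)"
  shows "Measurable.pred N (\<lambda>w. f w \<in> F w)"
proof -
  have "f w \<in> F w \<longleftrightarrow> (\<forall>k. \<exists>z\<in>PiE {..<d} (\<lambda>_. UNIV). f w \<in> {y \<in> space (euclid d). cell d k y = z} \<and>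
      card (F w \<inter> {y \<in> space (euclid d). cell d k y = z}) \<noteq> 0)" if "w \<in> space N" for w
    using that measurable_space[OF assms(1)] measurable_space[OF assms(2)]
    by (subst mem_config_iff) (auto simp: space_config_space)
  moreover have "countable (PiE {..<d} (\<lambda>_. UNIV :: int set))"
    by (intro countable_PiE) auto
  ultimately show ?thesis
    by (subst measurable_cong[of N]) (assumption, measurable)
qed

text \<open>A configuration is a set, so inserting a point of \<open>B\<close> changes the count in
  \<open>B\<close> only if the point is not yet present. Measurability of membership is therefore
  the real input, here and for removal.\<close>

lemma insert_config_measurable [measurable (raw)]:
  assumes [measurable]: "f \<in> measurable N (euclid d)" "F \<in> measurable N (config_space d)"
  shows "(\<lambda>w. insert (f w) (F w)) \<in> measurable N (config_space d)"
proof (rule measurable_config_spaceI)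
  have F: "F w \<in> configs d" "f w \<in> space (euclid d)" if "w \<in> space N" for w
    using that measurable_space[OF assms(1)] measurable_space[OF assms(2)]
    by (auto simp: space_config_space)
  then show "insert (f w) (F w) \<in> configs d" if "w \<in> space N" for w
    using that by (auto simp: configs_def)
  fix B assume [measurable]: "B \<in> sets (euclid d)"
  have "card (insert (f w) (F w) \<inter> B) = card (F w \<inter> B) + (if f w \<in> B \<and> f w \<notin> F w then 1 else 0)"
    if "w \<in> space N" for w
    using configs_finite[OF F(1)[OF that]] by (auto simp: Int_insert_left insert_absorb)
  then show "(\<lambda>w. card (insert (f w) (F w) \<inter> B)) \<in> measurable N (count_space UNIV)"
    by (subst measurable_cong[of N]) (assumption, measurable)
qed

lemma remove_config_measurable [measurable (raw)]:
  assumes [measurable]: "f \<in> measurable N (euclid d)" "F \<in> measurable N (config_space d)"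
  shows "(\<lambda>w. F w - {f w}) \<in> measurable N (config_space d)"
proof (rule measurable_config_spaceI)
  have F: "F w \<in> configs d" if "w \<in> space N" for w
    using that measurable_space[OF assms(2)] by (auto simp: space_config_space)
  then show "F w - {f w} \<in> configs d" if "w \<in> space N" for w
    using that by (auto simp: configs_def)
  fix B assume [measurable]: "B \<in> sets (euclid d)"
  have "card ((F w - {f w}) \<inter> B) = card (F w \<inter> B) - (if f w \<in> B \<and> f w \<in> F w then 1 else 0)"
    if "w \<in> space N" for w
    using configs_finite[OF F[OF that]] by (auto simp: Diff_Int_distrib2 Int_insert_left)
  then show "(\<lambda>w. card ((F w - {f w}) \<inter> B)) \<in> measurable N (count_space UNIV)"
    by (subst measurable_cong[of N]) (assumption, measurable)
qed

lemma empty_in_configs [simp]: "{} \<in> configs d"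
  by (simp add: configs_def)

lemma image_config_measurable:
  assumes "finite I" "\<And>i. i \<in> I \<Longrightarrow> f i \<in> measurable N (euclid d)"
  shows "(\<lambda>w. (\<lambda>i. f i w) ` I) \<in> measurable N (config_space d)"
  using assms
proof (induction I)
  case empty
  show ?case by (simp add: space_config_space)
next
  case (insert i I)
  have "(\<lambda>w. insert (f i w) ((\<lambda>i. f i w) ` I)) \<in> measurable N (config_space d)"
    using insert by (intro insert_config_measurable) auto
  then show ?case by simp
qed

text \<open>The index set varies with \<open>w\<close>, so measurability is reduced to counts: for a
  rectangle \<open>B \<times> C\<close> the sum is \<open>card (F w \<inter> B)\<close> times the
  indicator of \<open>C\<close>. A Dynkin argument extends this to measurable sets, and monotone
  approximation to nonnegative functions.\<close>

lemma sum_config_measurable [measurable (raw)]: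
  fixes g :: "point \<Rightarrow> 'w \<Rightarrow> ennreal"
  assumes F[measurable]: "F \<in> measurable N (config_space d)"
    and g: "case_prod g \<in> borel_measurable (euclid d \<Otimes>\<^sub>M N)"
  shows "(\<lambda>w. \<Sum>x\<in>F w. g x w) \<in> borel_measurable N"
proof -
  have fin: "finite (F w)" "F w \<subseteq> space (euclid d)" if "w \<in> space N" for w
    using measurable_space[OF F that] by (auto simp: space_config_space configs_def)
  have ind: "(\<lambda>w. \<Sum>x\<in>F w. indicator E (x, w) :: ennreal) \<in> borel_measurable N"
    if "E \<in> sets (euclid d \<Otimes>\<^sub>M N)" for E
    using Int_stable_pair_measure_generator pair_measure_closed that
    unfolding sets_pair_measure
  proof (induct rule: sigma_sets_induct_disjoint)
    case (basic A)
    then obtain B C where A: "A = B \<times> C" and [measurable]: "B \<in> sets (euclid d)" "C \<in> sets N"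
      by auto
    have "(\<Sum>x\<in>F w. indicator A (x, w) :: ennreal) = of_nat (card (F w \<inter> B)) * indicator C w"
      if "w \<in> space N" for w
      using fin[OF that] by (simp add: A indicator_times sum_distrib_right[symmetric] sum.If_cases
          indicator_def[of B] Int_def)
    then show ?case
      by (subst measurable_cong[of N]) (assumption, measurable)
  next
    \<comment> \<open>Complements need a subtraction in \<open>ennreal\<close>, legitimate because a
      sum of indicators over the finite set \<open>F w\<close> is finite.\<close>
    case (compl A)
    have "(\<Sum>x\<in>F w. indicator (space (euclid d) \<times> space N - A) (x, w) :: ennreal) =
        of_nat (card (F w \<inter> space (euclid d))) - (\<Sum>x\<in>F w. indicator A (x, w))" if "w \<in> space N" for w
    proof -
      have "(\<Sum>x\<in>F w. indicator (space (euclid d) \<times> space N - A) (x, w) :: ennreal) +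
          (\<Sum>x\<in>F w. indicator A (x, w)) = (\<Sum>x\<in>F w. 1)"
        unfolding sum.distrib[symmetric] using fin[OF that] that
        by (intro sum.cong) (auto simp: indicator_def)
      moreover have "(\<Sum>x\<in>F w. indicator A (x, w) :: ennreal) < top"
        using fin[OF that] by (auto simp: indicator_def of_nat_less_top)
      moreover have "a = c - b" if "a + b = c" "b < top" for a b c :: ennreal
        using that ennreal_add_diff_cancel_right[of b a] by auto
      ultimately have "(\<Sum>x\<in>F w. indicator (space (euclid d) \<times> space N - A) (x, w) :: ennreal) =
          (\<Sum>x\<in>F w. 1) - (\<Sum>x\<in>F w. indicator A (x, w))"
        by blast
      then show ?thesis
        using fin[OF that] by (simp add: Int_absorb2)
    qed
    then show ?case
      using compl by (subst measurable_cong[of N]) (assumption, measurable)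
  next
    case (union A)
    have "(\<Sum>x\<in>F w. indicator (\<Union>i. A i) (x, w) :: ennreal) = (\<Sum>i. \<Sum>x\<in>F w. indicator (A i) (x, w))" for w
      by (simp add: suminf_indicator[OF union(1), symmetric] suminf_sum[OF summableI])
    then show ?case
      using union by simp
  next
    case empty
    show ?case by simp
  qed
  show ?thesis
  proof -
    have "(\<lambda>w. \<Sum>x\<in>F w. h (x, w)) \<in> borel_measurable N"
      if "h \<in> borel_measurable (euclid d \<Otimes>\<^sub>M N)" for h :: "point \<times> 'w \<Rightarrow> ennreal"
      using that
    proof (induction rule: borel_measurable_induct)
      case (cong f h)
      have "(\<Sum>x\<in>F w. f (x, w)) = (\<Sum>x\<in>F w. h (x, w))" if "w \<in> space N" for w
        using fin[OF that] that cong by (intro sum.cong) (auto simp: space_pair_measure)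
      then have "(\<lambda>w. \<Sum>x\<in>F w. f (x, w)) \<in> borel_measurable N \<longleftrightarrow>
          (\<lambda>w. \<Sum>x\<in>F w. h (x, w)) \<in> borel_measurable N"
        by (rule measurable_cong)
      with cong show ?case by blast
    next
      case (set A)
      then show ?case by (rule ind)
    next
      case (mult u c)
      then show ?case by (simp add: sum_distrib_left[symmetric])
    next
      case (add u v)
      then show ?case by (simp add: sum.distrib)
    next
      case (seq U)
      have "(\<Sum>x\<in>F w. (SUP i. U i) (x, w)) = (SUP i. \<Sum>x\<in>F w. U i (x, w))" for w
        using \<open>incseq U\<close> by (subst ennreal_SUP_sum) (auto simp: incseq_def le_fun_def image_comp)
      then show ?case
        using seq by simp
    qed
    from this[OF g] show ?thesis by simp
  qed
qed

text \<open>The number of violating points is a sum over the configuration, and the quantified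
  statement says that it is zero.\<close>

lemma Ball_config_measurable [measurable (raw)]:
  assumes [measurable]: "F \<in> measurable N (config_space d)"
    and "Measurable.pred (euclid d \<Otimes>\<^sub>M N) (\<lambda>(x, w). P x w)"
  shows "Measurable.pred N (\<lambda>w. \<forall>x\<in>F w. P x w)"
proof -
  have [measurable]: "(\<lambda>(x, w). if P x w then 0 else 1 :: ennreal) \<in> borel_measurable (euclid d \<Otimes>\<^sub>M N)"
    using assms(2) by (simp add: case_prod_beta')
  have "(\<forall>x\<in>F w. P x w) \<longleftrightarrow> (\<Sum>x\<in>F w. if P x w then 0 else 1 :: ennreal) = 0" if "w \<in> space N" for w
    using measurable_space[OF assms(1) that]
    by (subst sum_nonneg_eq_0_iff) (auto simp: space_config_space configs_def)
  then show ?thesis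
    by (subst measurable_cong[of N]) (assumption, measurable)
qed

lemma eq_euclid_measurable:
  assumes [measurable]: "f \<in> measurable N (euclid d)" "g \<in> measurable N (euclid d)"
  shows "Measurable.pred N (\<lambda>w. f w = g w)"
proof -
  \<comment> \<open>Equality of two points is membership in the configuration \<open>{g w}\<close>,
    obtained by insertion into the empty one.\<close>
  have "(\<lambda>w. {}) \<in> measurable N (config_space d)"
    by (simp add: space_config_space)
  then have "Measurable.pred N (\<lambda>w. f w \<in> insert (g w) {})"
    by measurable
  then show ?thesis by simp
qed

lemma compat_measurable [measurable (raw)]:
  assumes [measurable]: "f \<in> measurable N (euclid d)" "F \<in> measurable N (config_space d)"
  shows "Measurable.pred N (\<lambda>w. \<forall>y\<in>F w. 2 * r \<le> edist d (f w) y)"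
  by measurable

lemma hard_core_measurable [measurable]: "Measurable.pred (config_space d) (hard_core d r)"
proof -
  have [measurable]: "Measurable.pred (euclid d \<Otimes>\<^sub>M euclid d \<Otimes>\<^sub>M config_space d) (\<lambda>w. fst (snd w) = fst w)"
    by (intro eq_euclid_measurable) measurable
  show ?thesis
    unfolding hard_core_def by measurable
qed

lemma hard_core_sets [measurable]: "{\<eta> \<in> configs d. hard_core d r \<eta>} \<in> sets (config_space d)"
  using predE[OF hard_core_measurable[of d r]] by (simp add: space_config_space)

lemma singleton_empty_sets [measurable]: "{{}} \<in> sets (config_space d)"
proof -
  have "{{}} = {\<eta> \<in> space (config_space d). card (\<eta> \<inter> space (euclid d)) = 0}"
    by (auto simp: space_config_space configs_def Int_absorb2)
  also have "\<dots> \<in> sets (config_space d)"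
    by measurable
  finally show ?thesis .
qed

subsection \<open>The Mecke formula\<close>

locale poisson_region =
  fixes d :: nat and lam :: real and \<Lambda> :: "point set"
  assumes d: "1 \<le> d" and lam: "0 \<le> lam" and \<Lambda> [measurable]: "\<Lambda> \<in> sets (euclid d)"
    and \<Lambda>_finite: "emeasure (euclid d) \<Lambda> < top"
begin

abbreviation U :: "point measure" where "U \<equiv> uniform_measure (euclid d) \<Lambda>"

abbreviation m :: real where "m \<equiv> lam * vol d \<Lambda>"

abbreviation poi :: "point set measure" where "poi \<equiv> poisson_process d lam \<Lambda>"

definition p :: "nat pmf" where "p = (if m = 0 then return_pmf 0 else poisson_pmf m)"

lemma m_nonneg: "0 \<le> m"
  using lam by (simp add: vol_def)

lemma emeasure_\<Lambda>: "emeasure (euclid d) \<Lambda> = ennreal (vol d \<Lambda>)"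
  using \<Lambda>_finite by (simp add: vol_def emeasure_eq_ennreal_measure)

text \<open>The case distinction in \<open>p\<close> disappears here: the formula covers
  \<open>m = 0\<close> as well, thanks to \<open>0 ^ 0 = 1\<close>.\<close>

lemma pmf_p: "pmf p n = m ^ n / fact n * exp (- m)"
proof (cases "m = 0")
  case True
  then have "p = return_pmf 0"
    unfolding p_def by (rule if_P)
  then show ?thesis
    using True by (cases n) (simp_all add: True)
next
  case False
  with m_nonneg have "0 < m" by linarith
  moreover have "p = poisson_pmf m"
    unfolding p_def using False by (rule if_not_P)
  ultimately show ?thesis
    by (simp only: pmf_poisson)
qed

text \<open>The shift identity of the Poisson weights; in \<open>mecke\<close> it trades the
  \<open>Suc n\<close> choices of a distinguished point for the factor \<open>m\<close>.\<close>

lemma p_Suc: "real (Suc n) * pmf p (Suc n) = m * pmf p n"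
  unfolding pmf_p by (simp add: divide_simps)

text \<open>If \<Lambda> has volume zero, \<open>U\<close> is the zero measure, so only a bound by 1
  is available in general; \<open>m \<noteq> 0\<close> restores mass 1.\<close>

lemma space_U: "emeasure U (space U) \<le> 1"
proof -
  have "emeasure U (space U) = emeasure (euclid d) (\<Lambda> \<inter> space (euclid d)) / emeasure (euclid d) \<Lambda>"
    by (subst emeasure_uniform_measure) auto
  also have "\<Lambda> \<inter> space (euclid d) = \<Lambda>"
    using sets.sets_into_space[OF \<Lambda>] by auto
  also have "emeasure (euclid d) \<Lambda> / emeasure (euclid d) \<Lambda> \<le> 1"
  proof (cases "emeasure (euclid d) \<Lambda> = 0")
    case True
    show ?thesis unfolding True by simp
  next
    case False
    then show ?thesis
      using \<Lambda>_finite by (subst ennreal_divide_self) auto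
  qed
  finally show ?thesis .
qed

lemma prob_space_U: "m \<noteq> 0 \<Longrightarrow> prob_space U"
  using \<Lambda>_finite by (intro prob_space_uniform_measure) (auto simp: vol_def measure_def)

sublocale product_sigma_finite "\<lambda>_::nat. U"
proof -
  interpret finite_measure U
    using space_U by (intro finite_measureI) (auto simp: top_unique)
  show "product_sigma_finite (\<lambda>_::nat. U)"
    by standard
qed

lemma U_integral:
  assumes [measurable]: "f \<in> borel_measurable (euclid d)"
  shows "ennreal m * (\<integral>\<^sup>+ x. f x \<partial>U) = ennreal lam * (\<integral>\<^sup>+ x\<in>\<Lambda>. f x \<partial>euclid d)"
proof (cases "vol d \<Lambda> = 0")
  case True
  then have "\<Lambda> \<in> null_sets (euclid d)"
    using emeasure_\<Lambda> by auto
  then have "(\<integral>\<^sup>+ x\<in>\<Lambda>. f x \<partial>euclid d) = 0"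
    by (rule nn_integral_null_set)
  then show ?thesis using True by simp
next
  case False
  then have v: "0 < vol d \<Lambda>"
    by (simp add: vol_def less_le)
  have "ennreal m * (\<integral>\<^sup>+ x. f x \<partial>U) =
      ennreal lam * (ennreal (vol d \<Lambda>) * ((\<integral>\<^sup>+ x\<in>\<Lambda>. f x \<partial>euclid d) / ennreal (vol d \<Lambda>)))"
    using v lam by (simp add: nn_integral_uniform_measure emeasure_\<Lambda> ennreal_mult mult.assoc)
  also have "ennreal (vol d \<Lambda>) * (I / ennreal (vol d \<Lambda>)) = I" for I
    using v by (simp add: ennreal_times_divide ennreal_mult_divide_eq mult.commute)
  finally show ?thesis .
qed

lemma image_measurable:
  "finite I \<Longrightarrow> (\<lambda>z. z ` I) \<in> measurable (Pi\<^sub>M I (\<lambda>_::nat. U)) (config_space d)"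
  by (rule image_config_measurable[where f = "\<lambda>i z. z i"])
     (auto cong: measurable_cong_sets intro: measurable_component_singleton[of _ _ "\<lambda>_. U", simplified])

lemma poisson_kernel:
  "(\<lambda>n. distr (\<Pi>\<^sub>M i\<in>{..<n}. U) (config_space d) (\<lambda>x. x ` {..<n}))
     \<in> measurable (measure_pmf p) (subprob_algebra (config_space d))"
proof -
  have "subprob_space (distr (\<Pi>\<^sub>M i\<in>{..<n}. U) (config_space d) (\<lambda>x. x ` {..<n}))" for n :: nat
  proof (rule subprob_spaceI)
    have "emeasure (\<Pi>\<^sub>M i\<in>{..<n}. U) (space (\<Pi>\<^sub>M i\<in>{..<n}. U)) = (\<Prod>i<n. emeasure U (space U))"
      unfolding space_PiM using emeasure_PiM[of "{..<n}" "\<lambda>_. space U"] by simp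
    also have "\<dots> \<le> 1"
      using space_U by (intro prod_le_1) auto
    finally show "emeasure (distr (\<Pi>\<^sub>M i\<in>{..<n}. U) (config_space d) (\<lambda>x. x ` {..<n}))
        (space (distr (\<Pi>\<^sub>M i\<in>{..<n}. U) (config_space d) (\<lambda>x. x ` {..<n}))) \<le> 1"
      using image_measurable[of "{..<n}"]
      by (subst emeasure_distr) (auto simp: measurable_space
          elim!: order_trans[rotated] intro!: emeasure_space)
    show "space (distr (\<Pi>\<^sub>M i\<in>{..<n}. U) (config_space d) (\<lambda>x. x ` {..<n})) \<noteq> {}"
      by (simp add: space_config_space) (use empty_in_configs[of d] in blast)
  qed
  then show ?thesis
    by (simp add: space_subprob_algebra cong: measurable_cong_sets)
qed

lemma poisson_process_eq:
  "poi = measure_pmf p \<bind> (\<lambda>n. distr (\<Pi>\<^sub>M i\<in>{..<n}. U) (config_space d) (\<lambda>x. x ` {..<n}))"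
  by (simp add: poisson_process_def p_def Let_def)

lemma sets_poisson [simp, measurable_cong]: "sets poi = sets (config_space d)"
  unfolding poisson_process_eq
  by (rule sets_bind[OF sets_kernel[OF poisson_kernel]]) auto

lemma space_poisson: "space poi = configs d"
  using sets_eq_imp_space_eq[OF sets_poisson] by (simp add: space_config_space)

lemma subprob_space_poisson: "subprob_space poi"
  unfolding poisson_process_eq
  by (intro subprob_space_bind[OF _ poisson_kernel] prob_space_imp_subprob_space
      prob_space_measure_pmf)

lemma nn_integral_poisson:
  assumes f: "f \<in> borel_measurable (config_space d)"
  shows "(\<integral>\<^sup>+ \<eta>. f \<eta> \<partial>poi) = (\<Sum>n. ennreal (pmf p n) * (\<integral>\<^sup>+ x. f (x ` {..<n}) \<partial>(\<Pi>\<^sub>M i\<in>{..<n}. U)))"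
  unfolding poisson_process_eq nn_integral_bind[OF f poisson_kernel] nn_integral_measure_pmf
  by (simp add: nn_integral_count_space_nat nn_integral_distr[OF image_measurable] f)

lemma emeasure_poisson_empty: "ennreal (exp (- m)) \<le> emeasure poi {{}}"
proof -
  have "emeasure poi {{}} = (\<integral>\<^sup>+ \<eta>. indicator {{}} \<eta> \<partial>poi)"
    by (subst nn_integral_indicator) auto
  also have "\<dots> = (\<Sum>n. ennreal (pmf p n) * (\<integral>\<^sup>+ x. indicator {{}} (x ` {..<n}) \<partial>(\<Pi>\<^sub>M i\<in>{..<n}. U)))"
    by (rule nn_integral_poisson) measurable
  \<comment> \<open>The term \<open>n = 0\<close> suffices: the product over no factors has mass 1
    and its configuration is empty.\<close>
  also have "\<dots> \<ge> (\<Sum>n\<in>{0}. ennreal (pmf p n) * (\<integral>\<^sup>+ x. indicator {{}} (x ` {..<n}) \<partial>(\<Pi>\<^sub>M i\<in>{..<n}. U)))"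
    by (rule sum_le_suminf) auto
  also have "(\<Sum>n\<in>{0}. ennreal (pmf p n) * (\<integral>\<^sup>+ x. indicator {{}} (x ` {..<n}) \<partial>(\<Pi>\<^sub>M i\<in>{..<n}. U))) =
      ennreal (exp (- m)) * emeasure (\<Pi>\<^sub>M i\<in>({} :: nat set). U) (space (\<Pi>\<^sub>M i\<in>({} :: nat set). U))"
    by (simp add: pmf_p lessThan_0)
  also have "emeasure (\<Pi>\<^sub>M i\<in>({} :: nat set). U) (space (\<Pi>\<^sub>M i\<in>({} :: nat set). U)) = 1"
    by (simp add: space_PiM)
  finally show ?thesis by simp
qed

lemma emeasure_euclid_singleton:
  assumes "a \<in> space (euclid d)"
  shows "{a} \<in> sets (euclid d)" "emeasure (euclid d) {a} = 0"
proof -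
  interpret L: product_sigma_finite "\<lambda>_::nat. lborel :: real measure"
    by standard
  have a: "{a} = PiE {..<d} (\<lambda>i. {a i})"
    using assms by (auto simp: space_euclid intro: PiE_ext)
  show "{a} \<in> sets (euclid d)"
    unfolding a euclid_def by (intro sets_PiM_I_finite) auto
  have "emeasure (euclid d) {a} = (\<Prod>i<d. emeasure lborel {a i})"
    unfolding euclid_def by (subst a, subst L.emeasure_PiM) auto
  also have "\<dots> = 0"
    using d by (intro prod_zero bexI[of _ "0 :: nat"]) auto
  finally show "emeasure (euclid d) {a} = 0" .
qed

text \<open>Configurations are sets, so coinciding coordinates would merge into one point. With all
  coordinates but the \<open>i\<close>-th fixed, the latter would have to hit the singleton
  \<open>{z j}\<close>, which is null because \<open>1 \<le> d\<close>.\<close>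

lemma AE_distinct:
  fixes I :: "nat set"
  assumes "finite I"
  shows "AE z in Pi\<^sub>M I (\<lambda>_. U). inj_on z I"
proof -
  have "AE z in Pi\<^sub>M I (\<lambda>_. U). z i \<noteq> z j" if ij: "i \<in> I" "j \<in> I" "i \<noteq> j" for i j
  proof -
    let ?J = "I - {i}"
    have I: "insert i ?J = I" using ij by auto
    let ?f = "\<lambda>z. indicator {z. z i = z j} z :: ennreal"
    have comp: "(\<lambda>z. z k) \<in> measurable (Pi\<^sub>M I (\<lambda>_. U)) (euclid d)" if "k \<in> I" for k
      using measurable_component_singleton[OF that, of "\<lambda>_. U"] by (simp cong: measurable_cong_sets)
    have pred: "Measurable.pred (Pi\<^sub>M I (\<lambda>_. U)) (\<lambda>z. z i = z j)"
      using ij by (intro eq_euclid_measurable[of _ _ d] comp)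
    then have f: "?f \<in> borel_measurable (Pi\<^sub>M I (\<lambda>_. U))"
      by (simp add: indicator_def)
    have "(\<integral>\<^sup>+ z. ?f z \<partial>Pi\<^sub>M I (\<lambda>_. U)) =
        (\<integral>\<^sup>+ z. (\<integral>\<^sup>+ y. ?f (z(i := y)) \<partial>U) \<partial>Pi\<^sub>M ?J (\<lambda>_. U))"
      using product_nn_integral_insert[of ?J i ?f] f assms unfolding I by simp
    also have "\<dots> = (\<integral>\<^sup>+ z. 0 \<partial>Pi\<^sub>M ?J (\<lambda>_. U))"
    proof (intro nn_integral_cong)
      fix z assume "z \<in> space (Pi\<^sub>M ?J (\<lambda>_. U))"
      then have zj: "z j \<in> space (euclid d)"
        using ij by (auto simp: space_PiM)
      have "(\<integral>\<^sup>+ y. ?f (z(i := y)) \<partial>U) = (\<integral>\<^sup>+ y. indicator {z j} y \<partial>U)"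
        using ij by (intro nn_integral_cong) (auto simp: indicator_def)
      also have "\<dots> = emeasure (euclid d) (\<Lambda> \<inter> {z j}) / emeasure (euclid d) \<Lambda>"
        using emeasure_euclid_singleton[OF zj] by simp
      also have "emeasure (euclid d) (\<Lambda> \<inter> {z j}) = 0"
        by (rule emeasure_eq_0[OF emeasure_euclid_singleton[OF zj]]) (rule Int_lower2)
      also have "0 / emeasure (euclid d) \<Lambda> = 0"
        by simp
      finally show "(\<integral>\<^sup>+ y. ?f (z(i := y)) \<partial>U) = 0" .
    qed
    also have "\<dots> = 0"
      by simp
    finally have "AE z in Pi\<^sub>M I (\<lambda>_. U). ?f z = 0"
      using nn_integral_0_iff_AE[OF f] by blast
    then show ?thesis
      by (auto elim!: eventually_mono simp: indicator_def)
  qed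
  then have "AE z in Pi\<^sub>M I (\<lambda>_. U). \<forall>i\<in>I. \<forall>j\<in>I. i \<noteq> j \<longrightarrow> z i \<noteq> z j"
    using assms by (intro AE_finite_allI) auto
  then show ?thesis
    by (auto elim!: eventually_mono simp: inj_on_def)
qed

text \<open>Removing the index \<open>i\<close> from \<open>{..<Suc k}\<close> leaves
  \<open>k\<close> indices, possibly with a gap. Relabelling them along a bijection preserves the
  product of copies of \<open>U\<close>, a probability measure as \<open>m \<noteq> 0\<close>, and
  the set of points does not depend on the labels.\<close>

lemma nn_integral_image_card:
  fixes I :: "nat set"
  assumes m: "m \<noteq> 0" and I: "finite I" "card I = k" and h: "h \<in> borel_measurable (config_space d)"
  shows "(\<integral>\<^sup>+ z. h (z ` I) \<partial>Pi\<^sub>M I (\<lambda>_. U)) = (\<integral>\<^sup>+ z. h (z ` {..<k}) \<partial>Pi\<^sub>M {..<k} (\<lambda>_. U))"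
proof -
  obtain f where f: "bij_betw f {..<k} I"
    using I ex_bij_betw_nat_finite[OF I(1)] by (auto simp: atLeast0LessThan)
  let ?t = "\<lambda>z. \<lambda>n\<in>{..<k}. z (f n)"
  have *: "distr (Pi\<^sub>M I (\<lambda>_. U)) (Pi\<^sub>M {..<k} (\<lambda>_. U)) ?t = Pi\<^sub>M {..<k} (\<lambda>_. U)"
    using f prob_space_U[OF m] by (intro distr_PiM_reindex) (auto simp: bij_betw_def)
  have t: "?t \<in> measurable (Pi\<^sub>M I (\<lambda>_. U)) (Pi\<^sub>M {..<k} (\<lambda>_. U))"
    using f by (intro measurable_restrict measurable_component_singleton) (auto simp: bij_betw_def)
  have "(\<integral>\<^sup>+ z. h (z ` {..<k}) \<partial>Pi\<^sub>M {..<k} (\<lambda>_. U)) =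
      (\<integral>\<^sup>+ z. h (z ` {..<k}) \<partial>distr (Pi\<^sub>M I (\<lambda>_. U)) (Pi\<^sub>M {..<k} (\<lambda>_. U)) ?t)"
    by (simp only: *)
  also have "\<dots> = (\<integral>\<^sup>+ z. h (?t z ` {..<k}) \<partial>Pi\<^sub>M I (\<lambda>_. U))"
    by (rule nn_integral_distr[OF t])
       (simp add: measurable_compose[OF image_measurable[OF finite_lessThan] h])
  also have "\<dots> = (\<integral>\<^sup>+ z. h (z ` I) \<partial>Pi\<^sub>M I (\<lambda>_. U))"
  proof (intro nn_integral_cong)
    fix z :: "nat \<Rightarrow> point"
    have "?t z ` {..<k} = z ` (f ` {..<k})"
      by (simp add: image_image)
    also have "f ` {..<k} = I"
      using f by (simp add: bij_betw_def)
    finally show "h (?t z ` {..<k}) = h (z ` I)" by simp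
  qed
  finally show ?thesis by simp
qed

text \<open>The points are almost surely distinct, so the sum over points is a sum over indices.
  Integrating out coordinate \<open>i\<close> separates one independent point from the
  \<open>k\<close> others, with the same result for each of the \<open>Suc k\<close>
  indices.\<close>

lemma mecke_fixed_number:
  assumes m: "m \<noteq> 0" and F: "case_prod F \<in> borel_measurable (euclid d \<Otimes>\<^sub>M config_space d)"
  shows "(\<integral>\<^sup>+ z. (\<Sum>x\<in>z ` {..<Suc k}. F x (z ` {..<Suc k} - {x})) \<partial>Pi\<^sub>M {..<Suc k} (\<lambda>_. U)) =
    of_nat (Suc k) * (\<integral>\<^sup>+ z. (\<integral>\<^sup>+ y. F y (z ` {..<k}) \<partial>U) \<partial>Pi\<^sub>M {..<k} (\<lambda>_. U))"
proof -
  let ?A = "{..<Suc k}"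
  let ?P = "Pi\<^sub>M ?A (\<lambda>_. U)"
  have F': "case_prod F \<in> borel_measurable (U \<Otimes>\<^sub>M config_space d)"
    using F by (simp cong: measurable_cong_sets sets_pair_measure_cong)
  have G: "(\<lambda>\<eta>. \<integral>\<^sup>+ y. F y \<eta> \<partial>U) \<in> borel_measurable (config_space d)"
    using measurable_compose[OF measurable_pair_swap' F']
    by (intro sigma_finite_measure.borel_measurable_nn_integral sigma_finite_measures)
       (simp add: case_prod_beta')
  have meas: "(\<lambda>z. F (z i) (z ` (?A - {i}))) \<in> borel_measurable ?P" if "i \<in> ?A" for i
  proof -
    have 1: "(\<lambda>z. z i) \<in> measurable ?P U"
      using that by (rule measurable_component_singleton)
    have 2: "(\<lambda>z. (\<lambda>j. z j) ` (?A - {i})) \<in> measurable ?P (config_space d)"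
      by (rule image_config_measurable[where f = "\<lambda>i z. z i"])
         (auto cong: measurable_cong_sets intro: measurable_component_singleton[of _ _ "\<lambda>_. U", simplified])
    show ?thesis
      using measurable_compose[OF measurable_Pair[OF 1 2] F'] by simp
  qed
  have "(\<integral>\<^sup>+ z. (\<Sum>x\<in>z ` ?A. F x (z ` ?A - {x})) \<partial>?P) = (\<integral>\<^sup>+ z. (\<Sum>i\<in>?A. F (z i) (z ` (?A - {i}))) \<partial>?P)"
  proof (rule nn_integral_cong_AE)
    show "AE z in ?P. (\<Sum>x\<in>z ` ?A. F x (z ` ?A - {x})) = (\<Sum>i\<in>?A. F (z i) (z ` (?A - {i})))"
      using AE_distinct[of ?A, simplified]
    proof eventually_elim
      case (elim z)
      have "z ` ?A - {z i} = z ` (?A - {i})" if "i \<in> ?A" for i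
        using inj_on_image_set_diff[OF elim, of ?A "{i}"] that by simp
      then show ?case
        by (simp only: sum.reindex[OF elim] comp_def cong: sum.cong)
    qed
  qed
  also have "\<dots> = (\<Sum>i\<in>?A. \<integral>\<^sup>+ z. F (z i) (z ` (?A - {i})) \<partial>?P)"
    by (rule nn_integral_sum) (rule meas)
  also have "\<dots> = (\<Sum>i\<in>?A. \<integral>\<^sup>+ z. (\<integral>\<^sup>+ y. F y (z ` {..<k}) \<partial>U) \<partial>Pi\<^sub>M {..<k} (\<lambda>_. U))"
  proof (rule sum.cong[OF refl])
    fix i assume i: "i \<in> ?A"
    then have A: "insert i (?A - {i}) = ?A" by auto
    have "(\<integral>\<^sup>+ z. F (z i) (z ` (?A - {i})) \<partial>?P) =
        (\<integral>\<^sup>+ z. (\<integral>\<^sup>+ y. F ((z(i := y)) i) (z(i := y) ` (?A - {i})) \<partial>U) \<partial>Pi\<^sub>M (?A - {i}) (\<lambda>_. U))"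
      using product_nn_integral_insert[of "?A - {i}" i "\<lambda>z. F (z i) (z ` (?A - {i}))"] meas[OF i]
      unfolding A by simp
    also have "\<dots> = (\<integral>\<^sup>+ z. (\<integral>\<^sup>+ y. F y (z ` (?A - {i})) \<partial>U) \<partial>Pi\<^sub>M (?A - {i}) (\<lambda>_. U))"
    proof -
      have "z(i := y) ` (?A - {i}) = z ` (?A - {i})" for z :: "nat \<Rightarrow> point" and y
        by (intro image_cong) auto
      then show ?thesis by simp
    qed
    also have "\<dots> = (\<integral>\<^sup>+ z. (\<integral>\<^sup>+ y. F y (z ` {..<k}) \<partial>U) \<partial>Pi\<^sub>M {..<k} (\<lambda>_. U))"
      using i by (intro nn_integral_image_card[OF m _ _ G]) auto
    finally show "(\<integral>\<^sup>+ z. F (z i) (z ` (?A - {i})) \<partial>?P) =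
        (\<integral>\<^sup>+ z. (\<integral>\<^sup>+ y. F y (z ` {..<k}) \<partial>U) \<partial>Pi\<^sub>M {..<k} (\<lambda>_. U))" .
  qed
  finally show ?thesis by simp
qed

theorem mecke:
  assumes F[measurable]: "case_prod F \<in> borel_measurable (euclid d \<Otimes>\<^sub>M config_space d)"
  shows "(\<integral>\<^sup>+ \<eta>. (\<Sum>x\<in>\<eta>. F x (\<eta> - {x})) \<partial>poi) =
    (\<integral>\<^sup>+ \<eta>. ennreal lam * (\<integral>\<^sup>+ x\<in>\<Lambda>. F x \<eta> \<partial>euclid d) \<partial>poi)"
proof -
  let ?G = "\<lambda>\<eta>. \<integral>\<^sup>+ y. F y \<eta> \<partial>U"
  let ?J = "\<lambda>k. \<integral>\<^sup>+ z. ?G (z ` {..<k}) \<partial>Pi\<^sub>M {..<k} (\<lambda>_. U)"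
  have F': "case_prod F \<in> borel_measurable (U \<Otimes>\<^sub>M config_space d)"
    using F by (simp cong: measurable_cong_sets sets_pair_measure_cong)
  have G[measurable]: "?G \<in> borel_measurable (config_space d)"
    using measurable_compose[OF measurable_pair_swap' F']
    by (intro sigma_finite_measure.borel_measurable_nn_integral sigma_finite_measures)
       (simp add: case_prod_beta')
  have sum_meas: "(\<lambda>\<eta>. \<Sum>x\<in>\<eta>. F x (\<eta> - {x})) \<in> borel_measurable (config_space d)"
    using measurable_compose[OF _ F, of "\<lambda>w. (fst w, snd w - {fst w})" "euclid d \<Otimes>\<^sub>M config_space d"]
    by (intro sum_config_measurable[where d = d]) (simp_all add: case_prod_beta')
  let ?L = "\<lambda>n. \<integral>\<^sup>+ z. (\<Sum>x\<in>z ` {..<n}. F x (z ` {..<n} - {x})) \<partial>Pi\<^sub>M {..<n} (\<lambda>_. U)"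
  \<comment> \<open>This is \<open>mecke_fixed_number\<close> weighted by means of
    \<open>p_Suc\<close>; for \<open>m = 0\<close> both sides vanish.\<close>
  have step: "ennreal (pmf p (Suc n)) * ?L (Suc n) = ennreal m * (ennreal (pmf p n) * ?J n)" for n
  proof (cases "m = 0")
    case True
    have "pmf p (Suc n) = 0"
      using p_Suc[of n] unfolding True by simp
    then show ?thesis
      unfolding True by simp
  next
    case False
    have "ennreal (pmf p (Suc n)) * of_nat (Suc n) = ennreal (real (Suc n) * pmf p (Suc n))"
      by (simp only: ennreal_mult' of_nat_0_le_iff ennreal_of_nat_eq_real_of_nat mult.commute)
    also have "\<dots> = ennreal m * ennreal (pmf p n)"
      unfolding p_Suc using m_nonneg by (rule ennreal_mult')
    finally show ?thesis
      unfolding mecke_fixed_number[OF False F] by (simp only: mult.assoc[symmetric])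
  qed
  have zero: "(\<Sum>n<1. ennreal (pmf p n) * ?L n) = 0"
    by simp
  have "(\<integral>\<^sup>+ \<eta>. (\<Sum>x\<in>\<eta>. F x (\<eta> - {x})) \<partial>poi) = (\<Sum>n. ennreal (pmf p n) * ?L n)"
    by (rule nn_integral_poisson[OF sum_meas])
  \<comment> \<open>The term \<open>n = 0\<close> is an empty sum over points, so the series may be
    reindexed by \<open>Suc n\<close>.\<close>
  also have "\<dots> = (\<Sum>n. ennreal (pmf p (Suc n)) * ?L (Suc n)) + (\<Sum>n<1. ennreal (pmf p n) * ?L n)"
    using suminf_offset[OF summableI, of "\<lambda>n. ennreal (pmf p n) * ?L n" 1] by simp
  also have "\<dots> = (\<Sum>n. ennreal m * (ennreal (pmf p n) * ?J n))"
    unfolding step zero by (rule add_0_right)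
  also have "\<dots> = ennreal m * (\<integral>\<^sup>+ \<eta>. ?G \<eta> \<partial>poi)"
    by (simp add: nn_integral_poisson[OF G])
  also have "\<dots> = (\<integral>\<^sup>+ \<eta>. ennreal m * ?G \<eta> \<partial>poi)"
    by (rule nn_integral_cmult[symmetric]) simp
  also have "\<dots> = (\<integral>\<^sup>+ \<eta>. ennreal lam * (\<integral>\<^sup>+ x\<in>\<Lambda>. F x \<eta> \<partial>euclid d) \<partial>poi)"
    by (intro nn_integral_cong U_integral) (auto simp: space_poisson space_config_space)
  finally show ?thesis .
qed

end

subsection \<open>The hard sphere model\<close>

lemma sigma_finite_euclid: "sigma_finite_measure (euclid d)"
proof -
  interpret L: product_sigma_finite "\<lambda>_::nat. lborel :: real measure"
    by standard
  show ?thesis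
    unfolding euclid_def by (rule L.sigma_finite) simp
qed

lemma abs_coord_le_L2_set:
  fixes x :: point
  assumes "i < d"
  shows "\<bar>x i\<bar> \<le> L2_set x {..<d}"
  using member_le_L2_set[of "{..<d}" i "\<lambda>i. \<bar>x i\<bar>"] assms by (simp add: L2_set_def)

lemma emeasure_bounded_region:
  assumes "\<Lambda> \<in> sets (euclid d)" "bounded_region d \<Lambda>"
  shows "emeasure (euclid d) \<Lambda> < top"
proof -
  obtain R where R: "\<And>x. x \<in> \<Lambda> \<Longrightarrow> L2_set x {..<d} \<le> R"
    using assms by (auto simp: bounded_region_def)
  interpret L: product_sigma_finite "\<lambda>_::nat. lborel :: real measure"
    by standard
  let ?B = "PiE {..<d} (\<lambda>_. {-R..R})"
  have "x i \<in> {-R..R}" if "x \<in> \<Lambda>" "i < d" for x i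
    using abs_coord_le_L2_set[OF that(2), of x] R[OF that(1)] by auto
  then have "\<Lambda> \<subseteq> ?B"
    using sets.sets_into_space[OF assms(1)] by (auto simp: space_euclid PiE_def extensional_def)
  then have "emeasure (euclid d) \<Lambda> \<le> emeasure (euclid d) ?B"
    unfolding euclid_def by (intro emeasure_mono sets_PiM_I_finite) auto
  also have "emeasure (euclid d) ?B = (\<Prod>i<d. emeasure lborel {-R..R})"
    unfolding euclid_def by (rule L.emeasure_PiM) auto
  also have "\<dots> < top"
    by (simp add: emeasure_lborel_Icc_eq power_less_top_ennreal)
  finally show ?thesis .
qed

text \<open>Packing: points of a hard core configuration lie in distinct cells of a fine grid.\<close>

lemma hard_core_card_bound:
  assumes r: "0 < r" and \<Lambda>: "bounded_region d \<Lambda>"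
  shows "\<exists>N. \<forall>\<eta>. hard_core d r \<eta> \<longrightarrow> \<eta> \<in> configs d \<longrightarrow> \<eta> \<subseteq> \<Lambda> \<longrightarrow> card \<eta> \<le> N"
proof -
  obtain R where R: "\<And>x. x \<in> \<Lambda> \<Longrightarrow> L2_set x {..<d} \<le> R"
    using \<Lambda> by (auto simp: bounded_region_def)
  \<comment> \<open>Two points of one cell differ by at most 1/k in each coordinate, hence are at
    distance at most d/k, which this choice makes smaller than 2r.\<close>
  obtain k :: nat where k: "real d / (2 * r) < real k"
    using reals_Archimedean2 by blast
  then have k0: "0 < real k"
    using r by (intro le_less_trans[OF _ k]) simp
  define M where "M = \<lceil>real k * R\<rceil> + 1"
  let ?Z = "PiE {..<d} (\<lambda>_. {-M..M})"
  have fin: "finite ?Z"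
    by (intro finite_PiE) auto
  have "card \<eta> \<le> card ?Z" if \<eta>: "hard_core d r \<eta>" "\<eta> \<in> configs d" "\<eta> \<subseteq> \<Lambda>" for \<eta>
  proof (rule card_inj_on_le[OF _ _ fin])
    show "cell d k ` \<eta> \<subseteq> ?Z"
    proof (rule image_subsetI)
      fix x assume "x \<in> \<eta>"
      then have x: "L2_set x {..<d} \<le> R" using \<eta> R by auto
      have "\<lfloor>real k * x i\<rfloor> \<in> {-M..M}" if "i < d" for i
      proof -
        have "\<bar>real k * x i\<bar> \<le> real k * R"
          using abs_coord_le_L2_set[OF that, of x] x k0 by (simp add: abs_mult)
        then show ?thesis
          unfolding M_def atLeastAtMost_iff by linarith
      qed
      then show "cell d k x \<in> ?Z"
        by (auto simp: cell_def)
    qed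
    show "inj_on (cell d k) \<eta>"
    proof (rule inj_onI, rule ccontr)
      fix x y assume xy: "x \<in> \<eta>" "y \<in> \<eta>" "cell d k x = cell d k y" "x \<noteq> y"
      have le: "\<bar>x i - y i\<bar> \<le> 1 / real k" if "i < d" for i
      proof -
        have "\<lfloor>real k * x i\<rfloor> = \<lfloor>real k * y i\<rfloor>"
          using xy(3) that by (simp add: cell_eq_iff)
        then have "\<bar>real k * x i - real k * y i\<bar> \<le> 1"
          by linarith
        moreover have "\<bar>real k * x i - real k * y i\<bar> = real k * \<bar>x i - y i\<bar>"
          by (metis abs_mult abs_of_nat right_diff_distrib)
        ultimately show ?thesis
          using k0 by (simp add: pos_le_divide_eq mult.commute)
      qed
      have "edist d x y \<le> (\<Sum>i<d. \<bar>x i - y i\<bar>)"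
        unfolding edist_def by (rule L2_set_le_sum_abs)
      also have "\<dots> \<le> (\<Sum>i<d. 1 / real k)"
        using le by (intro sum_mono) auto
      also have "\<dots> < 2 * r"
        using k k0 r by (simp add: pos_divide_less_eq mult.commute)
      finally show False
        using \<eta>(1) xy unfolding hard_core_def by fastforce
    qed
  qed
  then show ?thesis by blast
qed

locale hard_sphere_region = poisson_region d lam \<Lambda> for d lam \<Lambda> +
  fixes r :: real
  assumes r: "0 < r" and \<Lambda>_bounded: "bounded_region d \<Lambda>"
begin

abbreviation Q where "Q \<equiv> glauber_rates d r lam \<Lambda>"

abbreviation \<mu> where "\<mu> \<equiv> hard_sphere d r lam \<Lambda>"

definition H where "H = {\<eta> \<in> configs d. hard_core d r \<eta>}"

text \<open>The state space for \<open>jump_rates\<close>: births happen inside \<Lambda>, so the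
  dynamics does not leave it; it carries \<mu> by \<open>AE_X\<close>; and packing limits the number
  of points, hence the total death rate.\<close>

definition X where "X = {\<eta> \<in> configs d. hard_core d r \<eta> \<and> \<eta> \<subseteq> \<Lambda>}"

definition N where "N = (SOME N. \<forall>\<eta>\<in>X. card \<eta> \<le> N)"

definition deaths :: "(point set \<Rightarrow> ennreal) \<Rightarrow> point set \<Rightarrow> ennreal" where
  "deaths f \<eta> = (\<Sum>x\<in>\<eta>. f (\<eta> - {x}))"

definition births :: "(point set \<Rightarrow> ennreal) \<Rightarrow> point set \<Rightarrow> ennreal" where
  "births f \<eta> = ennreal lam *
    (\<integral>\<^sup>+ x\<in>{x \<in> \<Lambda>. \<forall>y\<in>\<eta>. 2 * r \<le> edist d x y}. f (insert x \<eta>) \<partial>euclid d)"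

lemma Q_eq: "Q \<eta> f = deaths f \<eta> + births f \<eta>"
  by (simp add: glauber_rates_def deaths_def births_def)

lemma card_X: "\<eta> \<in> X \<Longrightarrow> card \<eta> \<le> N"
proof -
  have "\<exists>N. \<forall>\<eta>\<in>X. card \<eta> \<le> N"
    using hard_core_card_bound[OF r \<Lambda>_bounded] by (auto simp: X_def)
  from someI_ex[OF this] show "\<eta> \<in> X \<Longrightarrow> card \<eta> \<le> N"
    by (simp add: N_def)
qed

lemma X_configs: "\<eta> \<in> X \<Longrightarrow> \<eta> \<in> configs d"
  by (simp add: X_def)

lemma empty_in_X: "{} \<in> X"
  by (simp add: X_def hard_core_def)

lemma remove_in_X: "\<eta> \<in> X \<Longrightarrow> \<eta> - {x} \<in> X"
  by (auto simp: X_def hard_core_def configs_def)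

lemma insert_in_X:
  assumes "\<eta> \<in> X" "x \<in> \<Lambda>" "\<forall>y\<in>\<eta>. 2 * r \<le> edist d x y"
  shows "insert x \<eta> \<in> X"
  using assms sets.sets_into_space[OF \<Lambda>]
  by (auto simp: X_def hard_core_def configs_def edist_commute[of d _ x])

text \<open>Matches the two sides of \<open>detailed_balance\<close>: the death of \<open>x\<close>
  leads to an admissible configuration from which the birth of \<open>x\<close> is allowed, and
  conversely.\<close>

lemma H_remove_iff:
  assumes "x \<in> \<eta>" "\<eta> \<in> configs d"
  shows "\<eta> \<in> H \<longleftrightarrow> \<eta> - {x} \<in> H \<and> (\<forall>y\<in>\<eta> - {x}. 2 * r \<le> edist d x y)"
proof
  assume "\<eta> \<in> H"
  then show "\<eta> - {x} \<in> H \<and> (\<forall>y\<in>\<eta> - {x}. 2 * r \<le> edist d x y)"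
    using assms by (auto simp: H_def hard_core_def configs_def)
next
  assume R: "\<eta> - {x} \<in> H \<and> (\<forall>y\<in>\<eta> - {x}. 2 * r \<le> edist d x y)"
  have "2 * r \<le> edist d a b" if ab: "a \<in> \<eta>" "b \<in> \<eta>" "a \<noteq> b" for a b
  proof -
    consider "a = x" | "b = x" | "a \<in> \<eta> - {x}" "b \<in> \<eta> - {x}"
      using ab by blast
    then show ?thesis
    proof cases
      case 2
      then show ?thesis
        using R ab by (subst edist_commute) auto
    qed (use R ab in \<open>auto simp: H_def hard_core_def\<close>)
  qed
  then show "\<eta> \<in> H"
    using assms(2) by (auto simp: H_def hard_core_def)
qed

lemma H_sets [measurable]: "H \<in> sets (config_space d)"
  unfolding H_def by (rule hard_core_sets)

section \<open>The Glauber rates as a jump process with bounded rates\<close>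

lemma compat_sets:
  assumes "\<eta> \<in> configs d"
  shows "{x \<in> \<Lambda>. \<forall>y\<in>\<eta>. 2 * r \<le> edist d x y} \<in> sets (euclid d)"
proof -
  have [measurable]: "(\<lambda>x. \<eta>) \<in> measurable (euclid d) (config_space d)"
    using assms by (simp add: space_config_space)
  have "{x \<in> \<Lambda>. \<forall>y\<in>\<eta>. 2 * r \<le> edist d x y} =
      \<Lambda> \<inter> {x \<in> space (euclid d). \<forall>y\<in>\<eta>. 2 * r \<le> edist d x y}"
    using sets.sets_into_space[OF \<Lambda>] by auto
  also have "\<dots> \<in> sets (euclid d)"
    by measurable
  finally show ?thesis .
qed

lemma insert_fixed_measurable:
  assumes "\<eta> \<in> configs d" "f \<in> borel_measurable (config_space d)"
  shows "(\<lambda>x. f (insert x \<eta>)) \<in> borel_measurable (euclid d)"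
proof (rule measurable_compose[OF _ assms(2)])
  have [measurable]: "(\<lambda>x. \<eta>) \<in> measurable (euclid d) (config_space d)"
    using assms by (simp add: space_config_space)
  show "(\<lambda>x. insert x \<eta>) \<in> measurable (euclid d) (config_space d)"
    by measurable
qed

lemma births_measurable_pair:
  assumes F: "case_prod F \<in> borel_measurable (M \<Otimes>\<^sub>M config_space d)"
  shows "(\<lambda>(t, \<eta>). births (F t) \<eta>) \<in> borel_measurable (M \<Otimes>\<^sub>M config_space d)"
proof -
  let ?N = "(M \<Otimes>\<^sub>M config_space d) \<Otimes>\<^sub>M euclid d"
  interpret sigma_finite_measure "euclid d"
    by (rule sigma_finite_euclid)
  have [measurable]: "(\<lambda>w. F (fst (fst w)) (insert (snd w) (snd (fst w)))) \<in> borel_measurable ?N"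
    using measurable_compose[OF _ F, of "\<lambda>w. (fst (fst w), insert (snd w) (snd (fst w)))" ?N] by simp
  have "(\<lambda>w. F (fst (fst w)) (insert (snd w) (snd (fst w))) *
      (if snd w \<in> \<Lambda> \<and> (\<forall>y\<in>snd (fst w). 2 * r \<le> edist d (snd w) y) then 1 else 0)) \<in> borel_measurable ?N"
    by measurable
  then have "(\<lambda>w. \<integral>\<^sup>+ x. F (fst w) (insert x (snd w)) *
      (if x \<in> \<Lambda> \<and> (\<forall>y\<in>snd w. 2 * r \<le> edist d x y) then 1 else 0) \<partial>euclid d)
      \<in> borel_measurable (M \<Otimes>\<^sub>M config_space d)"
    by (intro borel_measurable_nn_integral) (simp add: case_prod_beta')
  then have "(\<lambda>w. births (F (fst w)) (snd w)) \<in> borel_measurable (M \<Otimes>\<^sub>M config_space d)"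
    unfolding births_def indicator_def of_bool_def mem_Collect_eq
    by (intro borel_measurable_times_ennreal borel_measurable_const)
  then show ?thesis
    by (simp add: case_prod_beta')
qed

lemma deaths_measurable_pair:
  assumes F: "case_prod F \<in> borel_measurable (M \<Otimes>\<^sub>M config_space d)"
  shows "(\<lambda>(t, \<eta>). deaths (F t) \<eta>) \<in> borel_measurable (M \<Otimes>\<^sub>M config_space d)"
proof -
  let ?N = "euclid d \<Otimes>\<^sub>M (M \<Otimes>\<^sub>M config_space d)"
  have "(\<lambda>w. F (fst (snd w)) (snd (snd w) - {fst w})) \<in> borel_measurable ?N"
    using measurable_compose[OF _ F, of "\<lambda>w. (fst (snd w), snd (snd w) - {fst w})" ?N] by simp
  then show ?thesis
    unfolding deaths_def case_prod_beta'
    by (intro sum_config_measurable[where d = d]) (simp_all add: case_prod_beta')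
qed

lemma Q_measurable_pair:
  assumes "case_prod F \<in> borel_measurable (M \<Otimes>\<^sub>M config_space d)"
  shows "(\<lambda>(t, \<eta>). Q \<eta> (F t)) \<in> borel_measurable (M \<Otimes>\<^sub>M config_space d)"
  unfolding Q_eq
  using borel_measurable_add[OF deaths_measurable_pair[OF assms] births_measurable_pair[OF assms]]
  by (simp add: case_prod_beta')

lemma births_measurable [measurable]:
  assumes "f \<in> borel_measurable (config_space d)"
  shows "births f \<in> borel_measurable (config_space d)"
proof -
  have "(\<lambda>(t::real, \<eta>). births f \<eta>) \<in> borel_measurable (borel \<Otimes>\<^sub>M config_space d)"
    using assms by (intro births_measurable_pair) simp
  from measurable_compose[OF _ this, of "\<lambda>\<eta>. (0, \<eta>)" "config_space d"] show ?thesis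
    by simp
qed

lemma deaths_measurable [measurable]:
  assumes "f \<in> borel_measurable (config_space d)"
  shows "deaths f \<in> borel_measurable (config_space d)"
proof -
  have "(\<lambda>(t::real, \<eta>). deaths f \<eta>) \<in> borel_measurable (borel \<Otimes>\<^sub>M config_space d)"
    using assms by (intro deaths_measurable_pair) simp
  from measurable_compose[OF _ this, of "\<lambda>\<eta>. (0, \<eta>)" "config_space d"] show ?thesis
    by simp
qed

text \<open>At most \<open>N\<close> points die at rate 1 each, and births have total rate at most
  \<lambda>|\<Lambda>|.\<close>

definition b :: real where "b = real N + m"

lemma deaths_one: "deaths (\<lambda>_. 1) \<eta> = of_nat (card \<eta>)"
  by (simp add: deaths_def)

lemma births_one_le:
  assumes "\<eta> \<in> configs d"
  shows "births (\<lambda>_. 1) \<eta> \<le> ennreal m"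
proof -
  have "births (\<lambda>_. 1) \<eta> = ennreal lam * emeasure (euclid d) {x \<in> \<Lambda>. \<forall>y\<in>\<eta>. 2 * r \<le> edist d x y}"
    using compat_sets[OF assms] by (simp add: births_def)
  also have "\<dots> \<le> ennreal lam * emeasure (euclid d) \<Lambda>"
    by (intro mult_left_mono emeasure_mono) auto
  also have "\<dots> = ennreal m"
    using lam by (simp add: emeasure_\<Lambda> ennreal_mult')
  finally show ?thesis .
qed

lemma deaths_mono: "(\<And>\<zeta>. f \<zeta> \<le> g \<zeta>) \<Longrightarrow> deaths f \<eta> \<le> deaths g \<eta>"
  unfolding deaths_def by (intro sum_mono)

lemma births_mono: "(\<And>\<zeta>. f \<zeta> \<le> g \<zeta>) \<Longrightarrow> births f \<eta> \<le> births g \<eta>"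
  unfolding births_def by (intro mult_left_mono nn_integral_mono mult_right_mono) auto

sublocale jump_rates "config_space d" Q X b
proof
  show "X \<subseteq> space (config_space d)"
    by (auto simp: X_def space_config_space)
  show "0 \<le> b"
    using m_nonneg by (simp add: b_def)
  fix \<eta> :: "point set" and f g :: "point set \<Rightarrow> ennreal"
  show "Q \<eta> f \<le> Q \<eta> g" if "\<And>\<zeta>. f \<zeta> \<le> g \<zeta>"
    unfolding Q_eq using that by (intro add_mono deaths_mono births_mono)
  show "(\<lambda>(t, \<eta>). Q \<eta> (F t)) \<in> borel_measurable (borel \<Otimes>\<^sub>M config_space d)"
    if "case_prod F \<in> borel_measurable (borel \<Otimes>\<^sub>M config_space d)" for F :: "real \<Rightarrow> _"
    using that by (rule Q_measurable_pair)
  assume \<eta>: "\<eta> \<in> X"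
  have \<eta>c: "\<eta> \<in> configs d"
    using \<eta> by (rule X_configs)
  let ?C = "{x \<in> \<Lambda>. \<forall>y\<in>\<eta>. 2 * r \<le> edist d x y}"
  note C [measurable] = compat_sets[OF \<eta>c]
  show "Q \<eta> f = Q \<eta> g" if "\<And>\<zeta>. \<zeta> \<in> X \<Longrightarrow> f \<zeta> = g \<zeta>"
  proof -
    have "(\<integral>\<^sup>+ x\<in>?C. f (insert x \<eta>) \<partial>euclid d) = (\<integral>\<^sup>+ x\<in>?C. g (insert x \<eta>) \<partial>euclid d)"
      using that insert_in_X[OF \<eta>] by (intro nn_integral_cong) (auto simp: indicator_def)
    moreover have "deaths f \<eta> = deaths g \<eta>"
      unfolding deaths_def by (intro sum.cong refl that remove_in_X \<eta>)
    ultimately show ?thesis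
      by (simp add: Q_eq births_def)
  qed
  show "Q \<eta> (\<lambda>\<zeta>. f \<zeta> + g \<zeta>) = Q \<eta> f + Q \<eta> g"
    if fg: "f \<in> borel_measurable (config_space d)" "g \<in> borel_measurable (config_space d)"
  proof -
    note [measurable] = insert_fixed_measurable[OF \<eta>c fg(1)] insert_fixed_measurable[OF \<eta>c fg(2)]
    have "births (\<lambda>\<zeta>. f \<zeta> + g \<zeta>) \<eta> = births f \<eta> + births g \<eta>"
      unfolding births_def by (simp add: distrib_right nn_integral_add distrib_left)
    then show ?thesis
      by (simp add: Q_eq deaths_def sum.distrib add_ac)
  qed
  show "Q \<eta> (\<lambda>\<zeta>. c * f \<zeta>) = c * Q \<eta> f" if f: "f \<in> borel_measurable (config_space d)" for c
  proof -
    note [measurable] = insert_fixed_measurable[OF \<eta>c f]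
    have "births (\<lambda>\<zeta>. c * f \<zeta>) \<eta> = c * births f \<eta>"
      unfolding births_def by (simp add: mult.assoc nn_integral_cmult mult.left_commute)
    then show ?thesis
      by (simp add: Q_eq deaths_def sum_distrib_left distrib_left)
  qed
  show "Q \<eta> (\<lambda>\<zeta>. SUP n. F n \<zeta>) = (SUP n. Q \<eta> (F n))"
    if F: "incseq F" "\<And>n. F n \<in> borel_measurable (config_space d)" for F
  proof -
    have inc: "F n \<zeta> \<le> F k \<zeta>" if "n \<le> k" for n k \<zeta>
      using F(1) that by (auto simp: incseq_def le_fun_def)
    note [measurable] = insert_fixed_measurable[OF \<eta>c F(2)]
    have "(\<integral>\<^sup>+ x\<in>?C. (SUP n. F n (insert x \<eta>)) \<partial>euclid d) =
        (\<integral>\<^sup>+ x. (SUP n. F n (insert x \<eta>) * indicator ?C x) \<partial>euclid d)"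
      by (simp add: SUP_mult_right_ennreal)
    also have "\<dots> = (SUP n. \<integral>\<^sup>+ x. F n (insert x \<eta>) * indicator ?C x \<partial>euclid d)"
      by (rule nn_integral_monotone_convergence_SUP)
         (auto simp: incseq_def le_fun_def intro!: mult_right_mono inc)
    finally have births: "births (\<lambda>\<zeta>. SUP n. F n \<zeta>) \<eta> = (SUP n. births (F n) \<eta>)"
      by (simp add: births_def SUP_mult_left_ennreal)
    have deaths: "deaths (\<lambda>\<zeta>. SUP n. F n \<zeta>) \<eta> = (SUP n. deaths (F n) \<eta>)"
      unfolding deaths_def by (rule ennreal_SUP_sum[symmetric]) (auto simp: incseq_def inc)
    show ?thesis
      unfolding Q_eq births deaths
      by (rule ennreal_SUP_add[symmetric]) (auto simp: incseq_def inc intro!: deaths_mono births_mono)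
  qed
  show "Q \<eta> (\<lambda>_. 1) \<le> ennreal b"
  proof -
    have "Q \<eta> (\<lambda>_. 1) \<le> of_nat N + ennreal m"
      unfolding Q_eq deaths_one using card_X[OF \<eta>] births_one_le[OF \<eta>c] by (intro add_mono) auto
    also have "\<dots> = ennreal b"
      using m_nonneg by (simp add: b_def ennreal_of_nat_eq_real_of_nat)
    finally show ?thesis .
  qed
qed

section \<open>The hard sphere measure: support and reversibility\<close>

lemma H_positive: "ennreal (exp (- m)) \<le> emeasure poi H"
proof -
  have "emeasure poi {{}} \<le> emeasure poi H"
  proof (rule emeasure_mono)
    show "{{}} \<subseteq> H" by (auto simp: H_def hard_core_def)
  qed simp
  with emeasure_poisson_empty show ?thesis by (rule order_trans)
qed

lemma H_le_1: "emeasure poi H \<le> 1"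
  using subprob_space.subprob_emeasure_le_1[OF subprob_space_poisson] .

lemma H_nonzero: "emeasure poi H \<noteq> 0"
proof
  assume "emeasure poi H = 0"
  with H_positive have "ennreal (exp (- m)) \<le> 0" by (simp only:)
  then show False by (simp add: ennreal_eq_0_iff)
qed

lemma \<mu>_eq: "\<mu> = uniform_measure poi H"
  by (simp add: hard_sphere_def H_def)

lemma sets_\<mu>: "sets \<mu> = sets (config_space d)"
  by (simp add: \<mu>_eq)

lemma borel_measurable_\<mu>: "f \<in> borel_measurable (config_space d) \<Longrightarrow> f \<in> borel_measurable \<mu>"
  by (simp cong: measurable_cong_sets add: sets_\<mu>)

lemma prob_space_\<mu>: "prob_space \<mu>"
  unfolding \<mu>_eq using H_nonzero le_less_trans[OF H_le_1, of top]
  by (intro prob_space_uniform_measure) auto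

lemma nn_integral_\<mu>:
  assumes "f \<in> borel_measurable (config_space d)"
  shows "(\<integral>\<^sup>+ \<eta>. f \<eta> \<partial>\<mu>) = (\<integral>\<^sup>+ \<eta>. f \<eta> * indicator H \<eta> \<partial>poi) / emeasure poi H"
  unfolding \<mu>_eq by (rule nn_integral_uniform_measure) (use assms in \<open>auto cong: measurable_cong_sets\<close>)

text \<open>By the Mecke formula the expected number of points outside \<Lambda> is an integral over
  \<Lambda> of the indicator of its complement, hence zero.\<close>

lemma AE_subset_\<Lambda>: "AE \<eta> in poi. \<eta> \<subseteq> \<Lambda>"
proof -
  have [measurable]: "(\<lambda>x. indicator (- \<Lambda>) x :: ennreal) \<in> borel_measurable (euclid d)"
    by simp
  have s: "(\<lambda>\<eta>. \<Sum>x\<in>\<eta>. indicator (- \<Lambda>) x :: ennreal) \<in> borel_measurable (config_space d)"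
    by (intro sum_config_measurable[where d = d]) measurable
  have "(\<integral>\<^sup>+ \<eta>. (\<Sum>x\<in>\<eta>. indicator (- \<Lambda>) x) \<partial>poi) =
      (\<integral>\<^sup>+ \<eta>. ennreal lam * (\<integral>\<^sup>+ x\<in>\<Lambda>. indicator (- \<Lambda>) x \<partial>euclid d) \<partial>poi)"
    by (rule mecke[of "\<lambda>x _. indicator (- \<Lambda>) x"]) measurable
  also have "(\<integral>\<^sup>+ x\<in>\<Lambda>. indicator (- \<Lambda>) x \<partial>euclid d) = (\<integral>\<^sup>+ x. 0 \<partial>euclid d)"
    by (intro nn_integral_cong) (simp add: indicator_def)
  finally have "(\<integral>\<^sup>+ \<eta>. (\<Sum>x\<in>\<eta>. indicator (- \<Lambda>) x) \<partial>poi) = (0 :: ennreal)"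
    by simp
  then have "AE \<eta> in poi. (\<Sum>x\<in>\<eta>. indicator (- \<Lambda>) x) = (0 :: ennreal)"
    using s by (subst (asm) nn_integral_0_iff_AE) (auto cong: measurable_cong_sets)
  then show ?thesis
    using AE_space
  proof eventually_elim
    case (elim \<eta>)
    then have "finite \<eta>"
      by (simp add: space_poisson configs_def)
    with elim have "\<forall>x\<in>\<eta>. indicator (- \<Lambda>) x = (0 :: ennreal)"
      by (simp add: sum_nonneg_eq_0_iff)
    then show ?case
      by (auto simp: indicator_def split: if_splits)
  qed
qed

lemma AE_X: "AE \<eta> in \<mu>. \<eta> \<in> X"
  unfolding \<mu>_eq
proof (rule AE_uniform_measureI)
  show "AE \<eta> in poi. \<eta> \<in> H \<longrightarrow> \<eta> \<in> X"
    using AE_subset_\<Lambda> by eventually_elim (auto simp: H_def X_def)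
qed simp

text \<open>Reversibility: the death of a point at rate 1 balances its birth at rate \<lambda> dx.
  It is the Mecke formula for the Poisson process restricted to \<open>H\<close>; the normalising
  factor is common to both sides.\<close>

lemma detailed_balance:
  assumes f[measurable]: "f \<in> borel_measurable (config_space d)"
    and g[measurable]: "g \<in> borel_measurable (config_space d)"
  shows "(\<integral>\<^sup>+ \<eta>. f \<eta> * deaths g \<eta> \<partial>\<mu>) = (\<integral>\<^sup>+ \<eta>. g \<eta> * births f \<eta> \<partial>\<mu>)"
proof -
  \<comment> \<open>At \<open>x\<close> and \<open>\<eta> - {x}\<close> this is
    \<open>f \<eta> * g (\<eta> - {x})\<close> on \<open>H\<close>, by \<open>H_remove_iff\<close>;
    at a fixed \<eta> the last factor restricts \<open>x\<close> to the locations open for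
    births.\<close>
  define F where "F x \<eta> = f (insert x \<eta>) * g \<eta> * indicator H \<eta> *
    (if \<forall>y\<in>\<eta>. 2 * r \<le> edist d x y then 1 else 0 :: ennreal)" for x \<eta>
  have 1[measurable]: "(\<lambda>w. f (insert (fst w) (snd w))) \<in> borel_measurable (euclid d \<Otimes>\<^sub>M config_space d)"
    by (rule measurable_compose[OF _ f]) measurable
  have F: "case_prod F \<in> borel_measurable (euclid d \<Otimes>\<^sub>M config_space d)"
    unfolding F_def case_prod_beta' by measurable
  have "(\<integral>\<^sup>+ \<eta>. f \<eta> * deaths g \<eta> * indicator H \<eta> \<partial>poi) = (\<integral>\<^sup>+ \<eta>. (\<Sum>x\<in>\<eta>. F x (\<eta> - {x})) \<partial>poi)"
  proof (rule nn_integral_cong)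
    fix \<eta> assume "\<eta> \<in> space poi"
    then have \<eta>: "\<eta> \<in> configs d" by (simp add: space_poisson)
    have "F x (\<eta> - {x}) = f \<eta> * g (\<eta> - {x}) * indicator H \<eta>" if "x \<in> \<eta>" for x
      using H_remove_iff[OF that \<eta>] that by (auto simp: F_def insert_absorb indicator_def)
    then show "f \<eta> * deaths g \<eta> * indicator H \<eta> = (\<Sum>x\<in>\<eta>. F x (\<eta> - {x}))"
      by (simp add: deaths_def sum_distrib_left sum_distrib_right)
  qed
  also have "\<dots> = (\<integral>\<^sup>+ \<eta>. ennreal lam * (\<integral>\<^sup>+ x\<in>\<Lambda>. F x \<eta> \<partial>euclid d) \<partial>poi)"
    by (rule mecke[OF F])
  also have "\<dots> = (\<integral>\<^sup>+ \<eta>. g \<eta> * births f \<eta> * indicator H \<eta> \<partial>poi)"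
  proof (rule nn_integral_cong)
    fix \<eta> assume "\<eta> \<in> space poi"
    then have \<eta>: "\<eta> \<in> configs d" by (simp add: space_poisson)
    let ?C = "{x \<in> \<Lambda>. \<forall>y\<in>\<eta>. 2 * r \<le> edist d x y}"
    note [measurable] = insert_fixed_measurable[OF \<eta> f] compat_sets[OF \<eta>]
    have "(\<integral>\<^sup>+ x\<in>\<Lambda>. F x \<eta> \<partial>euclid d) =
        (\<integral>\<^sup>+ x. (g \<eta> * indicator H \<eta>) * (f (insert x \<eta>) * indicator ?C x) \<partial>euclid d)"
      by (intro nn_integral_cong) (simp add: F_def indicator_def mult_ac)
    also have "\<dots> = (g \<eta> * indicator H \<eta>) * (\<integral>\<^sup>+ x\<in>?C. f (insert x \<eta>) \<partial>euclid d)"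
      by (rule nn_integral_cmult) measurable
    finally show "ennreal lam * (\<integral>\<^sup>+ x\<in>\<Lambda>. F x \<eta> \<partial>euclid d) = g \<eta> * births f \<eta> * indicator H \<eta>"
      by (simp add: births_def mult_ac)
  qed
  finally show ?thesis
    by (simp add: nn_integral_\<mu>)
qed

text \<open>Detailed balance with one function constantly 1 turns the deaths part of
  \<open>f\<close> into the birth rate times \<open>f\<close>, and the births part into the death
  rate times \<open>f\<close>. The two rates add up to the exit rate.\<close>

lemma stationary:
  assumes f[measurable]: "f \<in> borel_measurable (config_space d)"
  shows "(\<integral>\<^sup>+ \<eta>. Q \<eta> f \<partial>\<mu>) = (\<integral>\<^sup>+ \<eta>. ennreal (q \<eta>) * f \<eta> \<partial>\<mu>)"
proof -
  have "(\<integral>\<^sup>+ \<eta>. Q \<eta> f \<partial>\<mu>) = (\<integral>\<^sup>+ \<eta>. deaths f \<eta> \<partial>\<mu>) + (\<integral>\<^sup>+ \<eta>. births f \<eta> \<partial>\<mu>)"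
    unfolding Q_eq by (intro nn_integral_add borel_measurable_\<mu> deaths_measurable births_measurable f)
  also have "(\<integral>\<^sup>+ \<eta>. deaths f \<eta> \<partial>\<mu>) = (\<integral>\<^sup>+ \<eta>. f \<eta> * births (\<lambda>_. 1) \<eta> \<partial>\<mu>)"
    using detailed_balance[of "\<lambda>_. 1" f] by simp
  also have "(\<integral>\<^sup>+ \<eta>. births f \<eta> \<partial>\<mu>) = (\<integral>\<^sup>+ \<eta>. f \<eta> * deaths (\<lambda>_. 1) \<eta> \<partial>\<mu>)"
    using detailed_balance[of f "\<lambda>_. 1"] by simp
  also have "(\<integral>\<^sup>+ \<eta>. f \<eta> * births (\<lambda>_. 1) \<eta> \<partial>\<mu>) + (\<integral>\<^sup>+ \<eta>. f \<eta> * deaths (\<lambda>_. 1) \<eta> \<partial>\<mu>) =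
      (\<integral>\<^sup>+ \<eta>. f \<eta> * births (\<lambda>_. 1) \<eta> + f \<eta> * deaths (\<lambda>_. 1) \<eta> \<partial>\<mu>)"
    by (intro nn_integral_add[symmetric] borel_measurable_\<mu>) measurable
  also have "\<dots> = (\<integral>\<^sup>+ \<eta>. ennreal (q \<eta>) * f \<eta> \<partial>\<mu>)"
  proof (rule nn_integral_cong_AE)
    show "AE \<eta> in \<mu>. f \<eta> * births (\<lambda>_. 1) \<eta> + f \<eta> * deaths (\<lambda>_. 1) \<eta> = ennreal (q \<eta>) * f \<eta>"
      using AE_X
    proof eventually_elim
      case (elim \<eta>)
      show ?case
        unfolding Q_one[OF elim, symmetric] Q_eq by (simp add: distrib_left distrib_right mult_ac add_ac)
    qed
  qed
  finally show ?thesis .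
qed

section \<open>The Dirichlet form as the quadratic form of the generator\<close>

definition rdeaths :: "(point set \<Rightarrow> real) \<Rightarrow> point set \<Rightarrow> real" where
  "rdeaths f \<eta> = enn2real (deaths (\<lambda>\<zeta>. ennreal (f \<zeta>)) \<eta>)"

definition rbirths :: "(point set \<Rightarrow> real) \<Rightarrow> point set \<Rightarrow> real" where
  "rbirths f \<eta> = enn2real (births (\<lambda>\<zeta>. ennreal (f \<zeta>)) \<eta>)"

lemma rdeaths_eq: "(\<And>\<zeta>. 0 \<le> f \<zeta>) \<Longrightarrow> rdeaths f \<eta> = (\<Sum>x\<in>\<eta>. f (\<eta> - {x}))"
  unfolding rdeaths_def deaths_def by (subst sum_ennreal) (simp_all add: sum_nonneg)

lemma
  assumes "\<eta> \<in> X" and f: "\<And>\<zeta>. f \<zeta> \<le> 1"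
  shows ennreal_rdeaths: "ennreal (rdeaths f \<eta>) = deaths (\<lambda>\<zeta>. ennreal (f \<zeta>)) \<eta>"
    and ennreal_rbirths: "ennreal (rbirths f \<eta>) = births (\<lambda>\<zeta>. ennreal (f \<zeta>)) \<eta>"
    and rdeaths_le: "rdeaths f \<eta> \<le> b"
    and rbirths_le: "rbirths f \<eta> \<le> b"
    and K_eq: "K f \<eta> = rdeaths f \<eta> + rbirths f \<eta>"
proof -
  have "Q \<eta> (\<lambda>\<zeta>. ennreal (f \<zeta>)) \<le> Q \<eta> (\<lambda>_. 1)"
    by (rule Q_mono) (simp add: f)
  also have "\<dots> \<le> ennreal b"
    by (rule Q_bound[OF \<open>\<eta> \<in> X\<close>])
  finally have le: "deaths (\<lambda>\<zeta>. ennreal (f \<zeta>)) \<eta> + births (\<lambda>\<zeta>. ennreal (f \<zeta>)) \<eta> \<le> ennreal b"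
    by (simp add: Q_eq)
  have D: "deaths (\<lambda>\<zeta>. ennreal (f \<zeta>)) \<eta> \<le> ennreal b" and B: "births (\<lambda>\<zeta>. ennreal (f \<zeta>)) \<eta> \<le> ennreal b"
    using order_trans[OF _ le] by (simp_all add: add_increasing2 add_increasing)
  show eD: "ennreal (rdeaths f \<eta>) = deaths (\<lambda>\<zeta>. ennreal (f \<zeta>)) \<eta>"
    unfolding rdeaths_def by (rule ennreal_enn2real[OF le_less_trans[OF D ennreal_less_top]])
  show eB: "ennreal (rbirths f \<eta>) = births (\<lambda>\<zeta>. ennreal (f \<zeta>)) \<eta>"
    unfolding rbirths_def by (rule ennreal_enn2real[OF le_less_trans[OF B ennreal_less_top]])
  show "rdeaths f \<eta> \<le> b"
    using D b_nonneg unfolding eD[symmetric] by (simp add: ennreal_le_iff)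
  show "rbirths f \<eta> \<le> b"
    using B b_nonneg unfolding eB[symmetric] by (simp add: ennreal_le_iff)
  show "K f \<eta> = rdeaths f \<eta> + rbirths f \<eta>"
    unfolding K_def Q_eq eD[symmetric] eB[symmetric]
    by (simp add: ennreal_plus[symmetric] rdeaths_def rbirths_def del: ennreal_plus)
qed

lemma rdeaths_measurable [measurable]:
  "f \<in> borel_measurable (config_space d) \<Longrightarrow> rdeaths f \<in> borel_measurable (config_space d)"
  unfolding rdeaths_def by measurable

lemma rbirths_measurable [measurable]:
  "f \<in> borel_measurable (config_space d) \<Longrightarrow> rbirths f \<in> borel_measurable (config_space d)"
  unfolding rbirths_def by measurable

lemma rdeaths_nonneg [simp]: "0 \<le> rdeaths f \<eta>"
  by (simp add: rdeaths_def)

lemma rbirths_nonneg [simp]: "0 \<le> rbirths f \<eta>"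
  by (simp add: rbirths_def)

lemma integrable_\<mu>:
  fixes f :: "point set \<Rightarrow> real"
  assumes "f \<in> borel_measurable (config_space d)" "\<And>\<eta>. \<eta> \<in> X \<Longrightarrow> \<bar>f \<eta>\<bar> \<le> B"
  shows "integrable \<mu> f"
proof -
  interpret prob_space \<mu> by (rule prob_space_\<mu>)
  show ?thesis
  proof (rule integrable_const_bound)
    show "AE \<eta> in \<mu>. norm (f \<eta>) \<le> B"
      using AE_X by eventually_elim (simp add: assms(2))
  qed (rule borel_measurable_\<mu>[OF assms(1)])
qed

lemma integral_detailed_balance:
  fixes f g :: "point set \<Rightarrow> real"
  assumes [measurable]: "f \<in> borel_measurable (config_space d)" "g \<in> borel_measurable (config_space d)"
    and f: "\<And>\<eta>. 0 \<le> f \<eta>" "\<And>\<eta>. f \<eta> \<le> 1" and g: "\<And>\<eta>. 0 \<le> g \<eta>" "\<And>\<eta>. g \<eta> \<le> 1"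
  shows "(LINT \<eta>|\<mu>. f \<eta> * rdeaths g \<eta>) = (LINT \<eta>|\<mu>. g \<eta> * rbirths f \<eta>)"
proof -
  have 1: "(\<integral>\<^sup>+ \<eta>. ennreal (f \<eta> * rdeaths g \<eta>) \<partial>\<mu>) =
      (\<integral>\<^sup>+ \<eta>. ennreal (f \<eta>) * deaths (\<lambda>\<zeta>. ennreal (g \<zeta>)) \<eta> \<partial>\<mu>)"
  proof (rule nn_integral_cong_AE)
    show "AE \<eta> in \<mu>. ennreal (f \<eta> * rdeaths g \<eta>) = ennreal (f \<eta>) * deaths (\<lambda>\<zeta>. ennreal (g \<zeta>)) \<eta>"
      using AE_X by eventually_elim (simp add: ennreal_mult f g ennreal_rdeaths)
  qed
  have 2: "(\<integral>\<^sup>+ \<eta>. ennreal (g \<eta> * rbirths f \<eta>) \<partial>\<mu>) =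
      (\<integral>\<^sup>+ \<eta>. ennreal (g \<eta>) * births (\<lambda>\<zeta>. ennreal (f \<zeta>)) \<eta> \<partial>\<mu>)"
  proof (rule nn_integral_cong_AE)
    show "AE \<eta> in \<mu>. ennreal (g \<eta> * rbirths f \<eta>) = ennreal (g \<eta>) * births (\<lambda>\<zeta>. ennreal (f \<zeta>)) \<eta>"
      using AE_X by eventually_elim (simp add: ennreal_mult f g ennreal_rbirths)
  qed
  have "(LINT \<eta>|\<mu>. f \<eta> * rdeaths g \<eta>) = enn2real (\<integral>\<^sup>+ \<eta>. ennreal (f \<eta> * rdeaths g \<eta>) \<partial>\<mu>)"
    by (rule integral_eq_nn_integral) (auto intro!: borel_measurable_\<mu> simp: f)
  also have "\<dots> = enn2real (\<integral>\<^sup>+ \<eta>. ennreal (g \<eta> * rbirths f \<eta>) \<partial>\<mu>)"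
    unfolding 1 2 by (subst detailed_balance) auto
  also have "\<dots> = (LINT \<eta>|\<mu>. g \<eta> * rbirths f \<eta>)"
    by (rule integral_eq_nn_integral[symmetric]) (auto intro!: borel_measurable_\<mu> simp: g)
  finally show ?thesis .
qed

text \<open>Expanding the square gives the deaths part of f^2, a cross term, and f^2 times the death
  rate. Under \<mu>, detailed balance turns the first into f^2 times the birth rate, and one half of
  the cross term into \<open>f \<eta> * rbirths f \<eta>\<close>. So removals alone account for both
  halves of the generator.\<close>

lemma dirichlet_form_eq:
  fixes f :: "point set \<Rightarrow> real"
  assumes fm[measurable]: "f \<in> borel_measurable (config_space d)"
    and f: "\<And>\<eta>. 0 \<le> f \<eta>" "\<And>\<eta>. f \<eta> \<le> 1"
  shows "dirichlet_form \<mu> f = (LINT \<eta>|\<mu>. q \<eta> * (f \<eta>)\<^sup>2 - f \<eta> * K f \<eta>)"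
proof -
  let ?f2 = "\<lambda>\<eta>. (f \<eta>)\<^sup>2"
  have f2: "0 \<le> ?f2 \<eta>" "?f2 \<eta> \<le> 1" for \<eta>
    using f[of \<eta>] by (auto intro: power_le_one)
  have bound: "\<bar>c * x\<bar> \<le> b" if "0 \<le> c" "c \<le> 1" "0 \<le> x" "x \<le> b" for c x
    using mult_mono[of c 1 x b] that by (simp add: abs_mult)
  have iD2: "integrable \<mu> (rdeaths ?f2)"
    by (rule integrable_\<mu>[of _ b]) (use rdeaths_le[of _ ?f2] f2 in auto)
  have iB1: "integrable \<mu> (\<lambda>\<eta>. ?f2 \<eta> * rbirths (\<lambda>_. 1) \<eta>)"
    by (rule integrable_\<mu>[OF _ bound], measurable) (auto intro: f2 rbirths_le)
  have iD1: "integrable \<mu> (\<lambda>\<eta>. ?f2 \<eta> * rdeaths (\<lambda>_. 1) \<eta>)"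
    by (rule integrable_\<mu>[OF _ bound], measurable) (auto intro: f2 rdeaths_le)
  have iD: "integrable \<mu> (\<lambda>\<eta>. f \<eta> * rdeaths f \<eta>)"
    by (rule integrable_\<mu>[OF _ bound], measurable) (auto intro: f rdeaths_le)
  have iB: "integrable \<mu> (\<lambda>\<eta>. f \<eta> * rbirths f \<eta>)"
    by (rule integrable_\<mu>[OF _ bound], measurable) (auto intro: f rbirths_le)
  have sq: "(\<Sum>x\<in>\<eta>. (f (\<eta> - {x}) - f \<eta>)\<^sup>2) =
      rdeaths ?f2 \<eta> - 2 * (f \<eta> * rdeaths f \<eta>) + ?f2 \<eta> * rdeaths (\<lambda>_. 1) \<eta>" for \<eta>
  proof -
    have "(\<Sum>x\<in>\<eta>. (f (\<eta> - {x}) - f \<eta>)\<^sup>2) =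
        (\<Sum>x\<in>\<eta>. ?f2 (\<eta> - {x}) - 2 * (f \<eta> * f (\<eta> - {x})) + ?f2 \<eta> * 1)"
      by (intro sum.cong) (auto simp: power2_eq_square algebra_simps)
    then show ?thesis
      by (simp only: rdeaths_eq f f2 zero_le_one sum.distrib sum_subtractf sum_distrib_left)
  qed
  have "dirichlet_form \<mu> f = (LINT \<eta>|\<mu>. rdeaths ?f2 \<eta>) - 2 * (LINT \<eta>|\<mu>. f \<eta> * rdeaths f \<eta>) +
      (LINT \<eta>|\<mu>. ?f2 \<eta> * rdeaths (\<lambda>_. 1) \<eta>)"
    unfolding dirichlet_form_def sq using iD2 iD iD1 by simp
  also have "(LINT \<eta>|\<mu>. rdeaths ?f2 \<eta>) = (LINT \<eta>|\<mu>. ?f2 \<eta> * rbirths (\<lambda>_. 1) \<eta>)"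
    using integral_detailed_balance[of "\<lambda>_. 1" ?f2] f2 by simp
  also have "(LINT \<eta>|\<mu>. ?f2 \<eta> * rbirths (\<lambda>_. 1) \<eta>) - 2 * (LINT \<eta>|\<mu>. f \<eta> * rdeaths f \<eta>) +
      (LINT \<eta>|\<mu>. ?f2 \<eta> * rdeaths (\<lambda>_. 1) \<eta>) =
      (LINT \<eta>|\<mu>. ?f2 \<eta> * rbirths (\<lambda>_. 1) \<eta> + ?f2 \<eta> * rdeaths (\<lambda>_. 1) \<eta> -
        (f \<eta> * rdeaths f \<eta> + f \<eta> * rbirths f \<eta>))"
    using iB1 iD1 iD iB integral_detailed_balance[OF fm fm f f] by simp
  also have "\<dots> = (LINT \<eta>|\<mu>. q \<eta> * ?f2 \<eta> - f \<eta> * K f \<eta>)"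
  proof (rule integral_cong_AE)
    show "AE \<eta> in \<mu>. ?f2 \<eta> * rbirths (\<lambda>_. 1) \<eta> + ?f2 \<eta> * rdeaths (\<lambda>_. 1) \<eta> -
        (f \<eta> * rdeaths f \<eta> + f \<eta> * rbirths f \<eta>) = q \<eta> * ?f2 \<eta> - f \<eta> * K f \<eta>"
      using AE_X
    proof eventually_elim
      case (elim \<eta>)
      have "q \<eta> = K (\<lambda>_. 1) \<eta>"
        by (simp add: exit_rate_def K_def)
      then show ?case
        using elim f(2) by (simp add: K_eq algebra_simps)
    qed
    show "(\<lambda>\<eta>. ?f2 \<eta> * rbirths (\<lambda>_. 1) \<eta> + ?f2 \<eta> * rdeaths (\<lambda>_. 1) \<eta> -
        (f \<eta> * rdeaths f \<eta> + f \<eta> * rbirths f \<eta>)) \<in> borel_measurable \<mu>"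
      by (rule borel_measurable_\<mu>) measurable
    show "(\<lambda>\<eta>. q \<eta> * ?f2 \<eta> - f \<eta> * K f \<eta>) \<in> borel_measurable \<mu>"
      by (rule borel_measurable_\<mu>) measurable
  qed
  finally show ?thesis .
qed

section \<open>The mixing bound\<close>

lemma \<mu>_empty: "exp (- m) \<le> measure \<mu> {{}}"
proof -
  have "emeasure \<mu> {{}} = emeasure poi (H \<inter> {{}}) / emeasure poi H"
    unfolding \<mu>_eq by (rule emeasure_uniform_measure) auto
  also have "H \<inter> {{}} = {{}}"
    by (auto simp: H_def hard_core_def)
  finally have eq: "emeasure \<mu> {{}} = emeasure poi {{}} / emeasure poi H" .
  have "ennreal (exp (- m)) \<le> emeasure poi {{}}"
    by (rule emeasure_poisson_empty)
  \<comment> \<open>Conditioning on \<open>H\<close> can only enlarge the mass of the empty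
    configuration, which lies in \<open>H\<close>, because \<open>H\<close> has mass at most 1.
    Dividing and multiplying cancel since that mass is neither 0 nor infinite.\<close>
  also have "\<dots> = emeasure poi {{}} / emeasure poi H * emeasure poi H"
    using H_nonzero le_less_trans[OF H_le_1, of top]
    by (simp add: ennreal_divide_times ennreal_mult_divide_eq)
  also have "\<dots> \<le> emeasure poi {{}} / emeasure poi H * 1"
    using H_le_1 by (intro mult_left_mono) auto
  also have "\<dots> = emeasure poi {{}} / emeasure poi H"
    by simp
  finally have "ennreal (exp (- m)) \<le> ennreal (measure \<mu> {{}})"
    using prob_space.finite_measure[OF prob_space_\<mu>]
    by (simp only: eq[symmetric] finite_measure.emeasure_eq_measure)
  then show ?thesis
    by simp
qed

text \<open>\<open>jump_law_close\<close> at the empty configuration, together with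
  \<open>\<mu>_empty\<close>, bounds the deviation by \<open>exp (m / 2 - \<gamma> * t)\<close>. The
  bound is the same for every event and so passes to the supremum in \<open>tv_dist\<close>.\<close>

lemma mixing:
  assumes "0 < \<gamma>" and P: "poincare d \<gamma> \<mu>" and "0 < \<epsilon>" "\<epsilon> < 1"
    and t: "m + ln (1 / \<epsilon>) \<le> \<gamma> * t"
  shows "tv_dist (glauber_law d r lam \<Lambda> t) \<mu> \<le> \<epsilon>"
proof -
  interpret P: poincare_jump_rates "config_space d" Q X b \<mu> \<gamma>
  proof (intro poincare_jump_rates.intro poincare_jump_rates_axioms.intro jump_rates_axioms
      prob_space_\<mu> sets_\<mu> AE_X stationary)
    show "\<gamma> * Var \<mu> f \<le> (LINT \<eta>|\<mu>. q \<eta> * (f \<eta>)\<^sup>2 - f \<eta> * K f \<eta>)"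
      if "f \<in> borel_measurable (config_space d)" "\<And>\<eta>. 0 \<le> f \<eta>" "\<And>\<eta>. f \<eta> \<le> 1" for f
    proof -
      have "\<exists>b. \<forall>\<eta>\<in>configs d. \<bar>f \<eta>\<bar> \<le> b"
        using that(2,3) by (intro exI[of _ 1]) simp
      then show ?thesis
        using P that(1) unfolding poincare_def dirichlet_form_eq[OF that, symmetric] by blast
    qed
  qed (use \<open>0 < \<gamma>\<close> in auto)
  have ln: "0 \<le> ln (1 / \<epsilon>)"
    using assms by simp
  have t0: "0 \<le> t"
    using t ln m_nonneg \<open>0 < \<gamma>\<close> by (metis add_nonneg_nonneg order_trans zero_le_mult_iff not_less)
  have pos: "0 < measure \<mu> {{}}"
    by (rule less_le_trans[OF exp_gt_zero \<mu>_empty])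
  have "exp (- \<gamma> * t) / sqrt (measure \<mu> {{}}) \<le> \<epsilon>"
  proof -
    have "exp (- (m / 2)) = sqrt (exp (- m))"
      by (intro real_sqrt_unique[symmetric]) (simp_all add: power2_eq_square exp_add[symmetric])
    also have "\<dots> \<le> sqrt (measure \<mu> {{}})"
      using \<mu>_empty by (rule real_sqrt_le_mono)
    finally have s: "exp (- (m / 2)) \<le> sqrt (measure \<mu> {{}})" .
    \<comment> \<open>The assumption on \<open>t\<close> gives
      \<open>- \<gamma> * t \<le> ln \<epsilon> - m\<close>, and \<open>m\<close> is
      nonnegative.\<close>
    have "exp (- \<gamma> * t) \<le> exp (ln \<epsilon> + - (m / 2))"
      using t m_nonneg assms by (simp add: ln_div)
    also have "\<dots> = \<epsilon> * exp (- (m / 2))"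
      unfolding exp_add using assms by simp
    also have "\<dots> \<le> \<epsilon> * sqrt (measure \<mu> {{}})"
      using s assms by (intro mult_left_mono) auto
    finally show ?thesis
      using pos by (subst pos_divide_le_eq) auto
  qed
  then have "\<bar>measure (jump_law (config_space d) Q {} t) A - measure \<mu> A\<bar> \<le> \<epsilon>"
    if "A \<in> sets (config_space d)" for A
    using P.jump_law_close[OF that empty_in_X singleton_empty_sets pos t0] by (rule order_trans[rotated])
  moreover have "sets (jump_law (config_space d) Q {} t) = sets (config_space d)"
    by (simp add: jump_law_def sets.sets_into_space sets.sigma_sets_eq sets.space_closed)
  ultimately show ?thesis
    unfolding tv_dist_def glauber_law_def by (intro cSUP_least) auto
qed

end

theorem mainTheorem8:
  shows "\<exists>C::real. C > 0 \<and>
    (\<forall>(d::nat) (r::real) (lam::real) (\<Lambda>::point set) (\<gamma>::real) (\<epsilon>::real) (t::real).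
       d \<ge> 1 \<longrightarrow> r > 0 \<longrightarrow> lam \<ge> 0 \<longrightarrow>
       \<Lambda> \<in> sets (euclid d) \<longrightarrow> bounded_region d \<Lambda> \<longrightarrow>
       \<gamma> > 0 \<longrightarrow> poincare d \<gamma> (hard_sphere d r lam \<Lambda>) \<longrightarrow>
       0 < \<epsilon> \<longrightarrow> \<epsilon> < 1 \<longrightarrow>
       t \<ge> C * (1 / \<gamma> * lam * vol d \<Lambda> + (1 + 1 / \<gamma>) * ln (1 / \<epsilon>)) \<longrightarrow>
       tv_dist (glauber_law d r lam \<Lambda> t) (hard_sphere d r lam \<Lambda>) \<le> \<epsilon>)"
proof (intro exI[of _ 1] conjI allI impI)
  fix d :: nat and r lam :: real and \<Lambda> :: "point set" and \<gamma> \<epsilon> t :: real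
  assume d: "1 \<le> d" and r: "0 < r" and lam: "0 \<le> lam"
    and \<Lambda>: "\<Lambda> \<in> sets (euclid d)" "bounded_region d \<Lambda>"
    and \<gamma>: "0 < \<gamma>" and P: "poincare d \<gamma> (hard_sphere d r lam \<Lambda>)"
    and \<epsilon>: "0 < \<epsilon>" "\<epsilon> < 1"
    and t: "1 * (1 / \<gamma> * lam * vol d \<Lambda> + (1 + 1 / \<gamma>) * ln (1 / \<epsilon>)) \<le> t"
  interpret hard_sphere_region d lam \<Lambda> r
    using d r lam \<Lambda> emeasure_bounded_region[OF \<Lambda>] by unfold_locales
  \<comment> \<open>With C = 1, multiplying the assumption on \<open>t\<close> by \<gamma> leaves
    the threshold of \<open>mixing\<close> plus the nonnegative term
    \<open>\<gamma> * ln (1 / \<epsilon>)\<close>.\<close>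
  have "\<gamma> * (1 / \<gamma> * lam * vol d \<Lambda> + (1 + 1 / \<gamma>) * ln (1 / \<epsilon>)) =
      lam * vol d \<Lambda> + ln (1 / \<epsilon>) + \<gamma> * ln (1 / \<epsilon>)"
    using \<gamma> by (simp add: algebra_simps)
  moreover have "0 \<le> \<gamma> * ln (1 / \<epsilon>)"
    using \<gamma> \<epsilon> by simp
  moreover have "\<gamma> * (1 / \<gamma> * lam * vol d \<Lambda> + (1 + 1 / \<gamma>) * ln (1 / \<epsilon>)) \<le> \<gamma> * t"
    using \<gamma> t by (intro mult_left_mono) auto
  ultimately show "tv_dist (glauber_law d r lam \<Lambda> t) (hard_sphere d r lam \<Lambda>) \<le> \<epsilon>"
    by (intro mixing[OF \<gamma> P \<epsilon>]) linarith
qed simp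

end
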